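(* Let $\Bbbk$ be a field, $W$ an irreducible Coxeter group with simple reflections indexed by $I$, $\mathbf d=(d_i)_{i\in I}$ integers with $d_i\geqslant 2$ for all $i$, and $1\leqslant k\leqslant\infty$, such that the nil-Hecke algebra $n\mathcal H(W,\mathbf d,J_{<k})$ is finite-dimensional over $\Bbbk$. The following are equivalent: (1) The algebra $n\mathcal H(W,\mathbf d,J_{<k})$ is Frobenius. (2) The space of right-primitive (equivalently, left-primitive) elements is one-dimensional. (3) The spaces of right-primitive, left-primitive, and primitive elements are all the same and have dimension one. (4) Exactly one of the following holds: (a) $W$ is a Coxeter group with no braid relation of length $k$ or more, and $d_i=2$ for all $i$; or (b) $W$ is of type $A_1$, with $\mathbf d=(d)$ for some $d\geqslant 3$.
   Context: A Coxeter group $W$ has a finite nonempty index set $I$ of simple reflections and a Coxeter matrix $(m_{ij})_{i,j\in I}$ with $m_{ii}=1$ and $m_{ij}=m_{ji}\in\{2,3,\dots,\infty\}$ for $i\ne j$. Let $J$ be the set of unordered pairs $\{a,b\}\subset I$, $a\neq b$, with $m_{ab}<\infty$. For $j=\{a,b\}\in J$ let $\mathbf v_j=\mathbf s_a\mathbf s_b\mathbf s_a\cdots$ and $\mathbf w_j=\mathbf s_b\mathbf s_a\mathbf s_b\cdots$ be the two alternating words with $m_{ab}$ letters each; these are the two sides of the braid relation for $j$, whose length is $\ell(\mathbf v_j)=\ell(\mathbf w_j)=m_{ab}$. For $J_0\subset J$ and $\mathbf d=(d_i)_{i\in I}$ with integers $d_i\geqslant 2$, the nil-Hecke algebra $n\mathcal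 H(W,\mathbf d,J_0)$ is the associative unital $\Bbbk$-algebra generated by $\{\mathbf s_i:i\in I\}$ with relations $$\mathbf s_i^{d_i}=0\ (i\in I),\qquad \mathbf v_j=\mathbf w_j\ (j\in J_0),\qquad \mathbf v_j=0=\mathbf w_j\ (j\in J\setminus J_0).$$ For $k\geqslant 1$ put $J_{<k}=\{j\in J:\ell(\mathbf v_j)<k\}$, and $J_{<\infty}=J$. $W$ is irreducible if the graph on $I$ with $i,j$ adjacent iff $m_{ij}\geqslant 3$ is connected; type $A_1$ means $|I|=1$. Let $\mathfrak m$ be the two-sided ideal of $n\mathcal H(W,\mathbf d,J_{<k})$ generated by $\{\mathbf s_i:i\in I\}$. An element $x$ is left-primitive if $\mathfrak m x=0$, right-primitive if $x\mathfrak m=0$, and primitive if it is both. A finite-dimensional $\Bbbk$-algebra $A$ is Frobenius if it admits a nondegenerate bilinear form $\sigma:A\times A\to\Bbbk$ with $\sigma(ab,c)=\sigma(a,bc)$ for all $a,b,c\in A$. *)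

theory Defs
  imports "HOL-Algebra.Embedded_Algebras" "HOL-Algebra.QuotRing"
    "HOL-Library.Poly_Mapping" "HOL-Library.Extended_Nat"
begin

text \<open>The index set is a finite type (hence finite and nonempty); \<open>m a b = \<infinity>\<close> means that there is
  no relation between \<open>a\<close> and \<open>b\<close>.\<close>

definition coxeter_matrix :: "('i \<Rightarrow> 'i \<Rightarrow> enat) \<Rightarrow> bool" where
  "coxeter_matrix m \<longleftrightarrow>
     (\<forall>i. m i i = 1) \<and> (\<forall>i j. m i j = m j i) \<and> (\<forall>i j. i \<noteq> j \<longrightarrow> 2 \<le> m i j)"

definition coxeter_irreducible :: "('i \<Rightarrow> 'i \<Rightarrow> enat) \<Rightarrow> bool" where
  "coxeter_irreducible m \<longleftrightarrow> (\<forall>i j. (\<lambda>a b. 3 \<le> m a b)\<^sup>*\<^sup>* i j)"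

definition braid_pairs :: "('i \<Rightarrow> 'i \<Rightarrow> enat) \<Rightarrow> 'i set set" where
  "braid_pairs m = {{a, b} | a b. a \<noteq> b \<and> m a b < \<infinity>}"

definition braid_pairs_below :: "('i \<Rightarrow> 'i \<Rightarrow> enat) \<Rightarrow> enat \<Rightarrow> 'i set set" where
  "braid_pairs_below m k = {{a, b} | a b. {a, b} \<in> braid_pairs m \<and> m a b < k}"

text \<open>The free algebra is the monoid algebra of the free monoid. Lists are wrapped because the
  product of \<^typ>\<open>'a \<Rightarrow>\<^sub>0 'b\<close> is the convolution along an additively written monoid.\<close>

datatype 'i free_monoid = Word "'i list"

instantiation free_monoid :: (type) monoid_add
begin

definition zero_free_monoid :: "'a free_monoid" where
  "0 = Word []"

fun plus_free_monoid :: "'a free_monoid \<Rightarrow> 'a free_monoid \<Rightarrow> 'a free_monoid" where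
  "Word u + Word v = Word (u @ v)"

instance
proof
  fix a b c :: "'a free_monoid"
  show "a + b + c = a + (b + c)" by (cases a; cases b; cases c) simp
  show "0 + a = a" by (cases a) (simp add: zero_free_monoid_def)
  show "a + 0 = a" by (cases a) (simp add: zero_free_monoid_def)
qed

end

type_synonym ('i, 'k) free_alg = "'i free_monoid \<Rightarrow>\<^sub>0 'k"

definition free_algebra :: "('i, 'k::field) free_alg ring" where
  "free_algebra = \<lparr>carrier = UNIV, mult = (*), one = 1, zero = 0, add = (+)\<rparr>"

lemma ring_free_algebra: "ring (free_algebra :: ('i, 'k::field) free_alg ring)"
proof (rule ringI)
  show "abelian_group (free_algebra :: ('i, 'k) free_alg ring)"
    by (rule abelian_groupI) (auto simp: free_algebra_def algebra_simps intro: exI[of _ "- _"])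
  show "Group.monoid (free_algebra :: ('i, 'k) free_alg ring)"
    by (rule monoidI) (auto simp: free_algebra_def algebra_simps)
qed (auto simp: free_algebra_def algebra_simps)

definition free_gen :: "'i \<Rightarrow> ('i, 'k::field) free_alg" where
  "free_gen i = Poly_Mapping.single (Word [i]) 1"

definition free_scalar :: "'k \<Rightarrow> ('i, 'k::field) free_alg" where
  "free_scalar c = Poly_Mapping.single 0 c"

fun alternating :: "nat \<Rightarrow> 'i \<Rightarrow> 'i \<Rightarrow> 'i list" where
  "alternating 0 a b = []"
| "alternating (Suc n) a b = a # alternating n b a"

text \<open>For \<open>j = {a, b}\<close> the two sides of the braid relation are \<open>braid_word m a b\<close> and
  \<open>braid_word m b a\<close>.\<close>

definition braid_word :: "('i \<Rightarrow> 'i \<Rightarrow> enat) \<Rightarrow> 'i \<Rightarrow> 'i \<Rightarrow> ('i, 'k::field) free_alg" where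
  "braid_word m a b = prod_list (map free_gen (alternating (the_enat (m a b)) a b))"

definition nil_hecke_relators ::
  "('i \<Rightarrow> 'i \<Rightarrow> enat) \<Rightarrow> ('i \<Rightarrow> nat) \<Rightarrow> 'i set set \<Rightarrow> ('i, 'k::field) free_alg set" where
  "nil_hecke_relators m d J0 =
     {free_gen i ^ d i | i. True}
     \<union> {braid_word m a b - braid_word m b a | a b. {a, b} \<in> J0}
     \<union> {braid_word m a b | a b. {a, b} \<in> braid_pairs m - J0}"

definition nil_hecke_ideal ::
  "('i \<Rightarrow> 'i \<Rightarrow> enat) \<Rightarrow> ('i \<Rightarrow> nat) \<Rightarrow> 'i set set \<Rightarrow> ('i, 'k::field) free_alg set" where
  "nil_hecke_ideal m d J0 = Idl\<^bsub>free_algebra\<^esub> (nil_hecke_relators m d J0)"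

definition nil_hecke ::
  "('i \<Rightarrow> 'i \<Rightarrow> enat) \<Rightarrow> ('i \<Rightarrow> nat) \<Rightarrow> 'i set set \<Rightarrow> ('i, 'k::field) free_alg set ring" where
  "nil_hecke m d J0 = free_algebra Quot nil_hecke_ideal m d J0"

definition nil_hecke_gen ::
  "('i \<Rightarrow> 'i \<Rightarrow> enat) \<Rightarrow> ('i \<Rightarrow> nat) \<Rightarrow> 'i set set \<Rightarrow> 'i \<Rightarrow> ('i, 'k::field) free_alg set" where
  "nil_hecke_gen m d J0 i = nil_hecke_ideal m d J0 +>\<^bsub>free_algebra\<^esub> free_gen i"

definition nil_hecke_scalar ::
  "('i \<Rightarrow> 'i \<Rightarrow> enat) \<Rightarrow> ('i \<Rightarrow> nat) \<Rightarrow> 'i set set \<Rightarrow> 'k \<Rightarrow> ('i, 'k::field) free_alg set" where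
  "nil_hecke_scalar m d J0 c = nil_hecke_ideal m d J0 +>\<^bsub>free_algebra\<^esub> free_scalar c"

definition nil_hecke_max_ideal ::
  "('i \<Rightarrow> 'i \<Rightarrow> enat) \<Rightarrow> ('i \<Rightarrow> nat) \<Rightarrow> 'i set set \<Rightarrow> ('i, 'k::field) free_alg set set" where
  "nil_hecke_max_ideal m d J0 = Idl\<^bsub>nil_hecke m d J0\<^esub> (range (nil_hecke_gen m d J0))"

definition left_primitives :: "('a, 'b) ring_scheme \<Rightarrow> 'a set \<Rightarrow> 'a set" where
  "left_primitives A M = {x \<in> carrier A. \<forall>y\<in>M. y \<otimes>\<^bsub>A\<^esub> x = \<zero>\<^bsub>A\<^esub>}"

definition right_primitives :: "('a, 'b) ring_scheme \<Rightarrow> 'a set \<Rightarrow> 'a set" where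
  "right_primitives A M = {x \<in> carrier A. \<forall>y\<in>M. x \<otimes>\<^bsub>A\<^esub> y = \<zero>\<^bsub>A\<^esub>}"

definition primitives :: "('a, 'b) ring_scheme \<Rightarrow> 'a set \<Rightarrow> 'a set" where
  "primitives A M = left_primitives A M \<inter> right_primitives A M"

text \<open>An algebra over the field \<open>'k\<close> is a ring \<open>A\<close> with a (central, unital) structure map
  \<open>\<eta> :: 'k \<Rightarrow> 'a\<close>; the scalar multiple of \<open>x\<close> by \<open>c\<close> is \<open>\<eta> c \<otimes> x\<close>. Dimensions over \<open>'k\<close> are
  dimensions over the subfield \<open>range \<eta>\<close>.\<close>

definition bilinear_form ::
  "('a, 'b) ring_scheme \<Rightarrow> ('k::field \<Rightarrow> 'a) \<Rightarrow> ('a \<Rightarrow> 'a \<Rightarrow> 'k) \<Rightarrow> bool" where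
  "bilinear_form A \<eta> \<sigma> \<longleftrightarrow>
     (\<forall>x\<in>carrier A. \<forall>y\<in>carrier A. \<forall>z\<in>carrier A.
        \<sigma> (x \<oplus>\<^bsub>A\<^esub> y) z = \<sigma> x z + \<sigma> y z \<and> \<sigma> x (y \<oplus>\<^bsub>A\<^esub> z) = \<sigma> x y + \<sigma> x z) \<and>
     (\<forall>c. \<forall>x\<in>carrier A. \<forall>y\<in>carrier A.
        \<sigma> (\<eta> c \<otimes>\<^bsub>A\<^esub> x) y = c * \<sigma> x y \<and> \<sigma> x (\<eta> c \<otimes>\<^bsub>A\<^esub> y) = c * \<sigma> x y)"

definition nondegenerate_form ::
  "('a, 'b) ring_scheme \<Rightarrow> ('a \<Rightarrow> 'a \<Rightarrow> 'k::field) \<Rightarrow> bool" where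
  "nondegenerate_form A \<sigma> \<longleftrightarrow>
     (\<forall>x\<in>carrier A. (\<forall>y\<in>carrier A. \<sigma> x y = 0) \<longrightarrow> x = \<zero>\<^bsub>A\<^esub>) \<and>
     (\<forall>y\<in>carrier A. (\<forall>x\<in>carrier A. \<sigma> x y = 0) \<longrightarrow> y = \<zero>\<^bsub>A\<^esub>)"

definition frobenius_algebra :: "('a, 'b) ring_scheme \<Rightarrow> ('k::field \<Rightarrow> 'a) \<Rightarrow> bool" where
  "frobenius_algebra A \<eta> \<longleftrightarrow>
     ring.finite_dimension A (range \<eta>) (carrier A) \<and>
     (\<exists>\<sigma>. bilinear_form A \<eta> \<sigma> \<and> nondegenerate_form A \<sigma> \<and>
        (\<forall>a\<in>carrier A. \<forall>b\<in>carrier A. \<forall>c\<in>carrier A.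
           \<sigma> (a \<otimes>\<^bsub>A\<^esub> b) c = \<sigma> a (b \<otimes>\<^bsub>A\<^esub> c)))"

end

theory Submission
  imports Defs Complex_Main
begin

text \<open>
  The defining relations only identify words with words or send words to zero. Hence the algebra
  has a basis of braid classes of \<^emph>\<open>nonzero\<close> words, those that no sequence of braid moves turns
  into a word with a killed factor: the coefficients at these classes are well defined
  (\<open>coeff_I\<close>) and determine an element (\<open>coeff_separates\<close>). So each of the conditions becomes a
  statement about words.

  If the right-primitive elements form a line, then any two nonzero words that admit no nonzero
  extension to the right are equivalent, because both lie on that line. Every nonzero word extends
  to such a word, so there is a \<^emph>\<open>socle word\<close>: a nonzero word to which every nonzero word can be
  extended on the right. Reversing words gives the same conclusion for left-primitive elements. A
  Frobenius form \<open>\<sigma>\<close> also puts the right-primitive elements on a line, since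
  \<open>\<sigma> x y = \<epsilon> y * \<sigma> x 1\<close> for right-primitive \<open>x\<close>, where \<open>\<epsilon> y\<close> is the constant term of \<open>y\<close>.

  A socle word forces \<open>case_a\<close> or \<open>case_b\<close>. Let there be at least two letters, let \<open>d i \<ge> 3\<close> and let \<open>j\<close> be
  a neighbour of \<open>i\<close>. In a finite-dimensional algebra the nonzero words have bounded length, whereas
  arbitrarily long prefixes of the powers of \<open>iij\<close>, \<open>iijj\<close> or \<open>iijk\<close> are nonzero unless \<open>m i j = 3\<close>,
  \<open>d j = 2\<close> and \<open>j\<close> is the only neighbour (for \<open>iijk\<close>, as soon as the braid relation of \<open>i\<close> and
  \<open>j\<close> is imposed). In that remaining situation braid moves cannot pull a letter \<open>i\<close> to the front of
  a nonzero word that begins with \<open>jii\<close> (\<open>double_letter_not_starts\<close>). But the socle word is equivalent to a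
  word that begins with \<open>jii\<close> and to one that begins with \<open>i\<close>. So all \<open>d i\<close> are 2, the
  socle word is reduced, and every letter can be its first one. Two letters can both be first in a
  reduced word only if a braid relation between them is imposed
  (\<open>reduced_starts_with_both\<close>), so all these relations are imposed and \<open>case_a\<close> holds. With a
  single letter \<open>i\<close> the cases differ only in whether \<open>d i\<close> is 2.

  Conversely, under \<open>case_a\<close> the nonzero words are the reduced words, a longest one has every reduced
  word as a prefix and as a suffix, and cancellation holds. Under \<open>case_b\<close> the same is
  true of the powers of one letter. For such a word \<open>t\<close> the coefficient of \<open>t\<close> in a product is a Frobenius form,
  and the multiples of \<open>t\<close> are exactly the left-primitive and exactly the right-primitive elements.

  The facts about reduced words come from the dual reflection representation, following Tits: if \<open>f\<close>
  is a vector with positive coordinates and \<open>w\<close> is a reduced word, then coordinate \<open>s\<close> of \<open>w f\<close> is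
  negative or positive according to whether \<open>w\<close> can be rewritten to begin with \<open>s\<close> or not
  (\<open>starts_with_iff\<close>). Cancellation, the effect of two initial letters and the longest word are all
  read off from these signs.
\<close>

section \<open>Words up to braid moves\<close>

lemma length_alternating [simp]: "length (alternating n a b) = n"
  by (induction n a b rule: alternating.induct) auto

lemma set_alternating: "set (alternating n a b) \<subseteq> {a, b}"
  by (induction n a b rule: alternating.induct) auto

lemma alternating_append:
  "alternating (n + k) a b =
     alternating n a b @ (if even n then alternating k a b else alternating k b a)"
  by (induction n a b rule: alternating.induct) auto

lemma rev_alternating:
  "rev (alternating n a b) = (if even n then alternating n b a else alternating n a b)"
proof (induction n arbitrary: a b)
  case (Suc n)
  have "alternating (Suc n) x y = alternating n x y @ [if even n then x else y]" for x y :: 'a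
    using alternating_append[of n 1 x y] by auto
  then show ?case by (simp add: Suc)
qed simp

locale braid_monoid =
  fixes m :: "'i \<Rightarrow> 'i \<Rightarrow> enat" and J0 :: "'i set set"
  assumes coxeter: "coxeter_matrix m" and J0: "J0 \<subseteq> braid_pairs m"
begin

text \<open>The order of the product of two reflections in the Coxeter group that has only the braid relations
  in \<open>J0\<close>; the value 0 encodes infinite order, including a finite \<open>m a b\<close> whose relation is not
  imposed.\<close>

definition ord :: "'i \<Rightarrow> 'i \<Rightarrow> nat" where
  "ord a b = (if {a, b} \<in> J0 then the_enat (m a b) else 0)"

lemma m_commute: "m a b = m b a"
  using coxeter by (auto simp: coxeter_matrix_def)

lemma ord_commute: "ord a b = ord b a"
  by (simp add: ord_def m_commute insert_commute)

lemma braid_pairsD: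
  assumes "{a, b} \<in> braid_pairs m"
  shows "a \<noteq> b" "m a b < \<infinity>" "2 \<le> the_enat (m a b)" "m a b = enat (the_enat (m a b))"
proof -
  obtain x y where xy: "{a, b} = {x, y}" "x \<noteq> y" "m x y < \<infinity>"
    using assms by (auto simp: braid_pairs_def)
  then have e: "a = x \<and> b = y \<or> a = y \<and> b = x" by (auto simp: doubleton_eq_iff)
  then show 1: "a \<noteq> b" "m a b < \<infinity>" using xy m_commute by auto
  then show "m a b = enat (the_enat (m a b))" by (cases "m a b") auto
  then show "2 \<le> the_enat (m a b)" using coxeter 1
    by (metis coxeter_matrix_def enat_ord_simps(1) numeral_eq_enat)
qed

lemma J0D:
  assumes "{a, b} \<in> J0"
  shows "a \<noteq> b" "2 \<le> ord a b" "m a b = enat (ord a b)"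
  using braid_pairsD[of a b] assms J0 by (auto simp: ord_def)

lemma ord_eq_0: "ord a b = 0 \<longleftrightarrow> {a, b} \<notin> J0"
  using J0D(2)[of a b] by (auto simp: ord_def)

inductive braid_step :: "'i list \<Rightarrow> 'i list \<Rightarrow> bool" where
  braid_step: "{a, b} \<in> J0 \<Longrightarrow>
     braid_step (p @ alternating (ord a b) a b @ q) (p @ alternating (ord a b) b a @ q)"

abbreviation braid_eq :: "'i list \<Rightarrow> 'i list \<Rightarrow> bool" (infix \<open>\<approx>\<close> 50) where
  "v \<approx> w \<equiv> braid_step\<^sup>*\<^sup>* v w"

lemma braid_step_sym: "braid_step v w \<Longrightarrow> braid_step w v"
proof (erule braid_step.cases)
  fix a b p q
  assume "v = p @ alternating (ord a b) a b @ q" "w = p @ alternating (ord a b) b a @ q"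
    "{a, b} \<in> J0"
  then show "braid_step w v"
    using braid_step[of b a p q] by (simp add: ord_commute[of b a] insert_commute)
qed

lemma braid_eq_sym: "v \<approx> w \<Longrightarrow> w \<approx> v"
  by (induction rule: rtranclp_induct) (auto dest: braid_step_sym intro: converse_rtranclp_into_rtranclp)

lemma braid_eq_trans: "u \<approx> v \<Longrightarrow> v \<approx> w \<Longrightarrow> u \<approx> w"
  by (rule rtranclp_trans)

lemma braid_step_context: "braid_step v w \<Longrightarrow> braid_step (x @ v @ y) (x @ w @ y)"
proof (erule braid_step.cases)
  fix a b p q
  assume "v = p @ alternating (ord a b) a b @ q" "w = p @ alternating (ord a b) b a @ q"
    "{a, b} \<in> J0"
  then show "braid_step (x @ v @ y) (x @ w @ y)"
    using braid_step[of a b "x @ p" "q @ y"] by simp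
qed

lemma braid_eq_context: "v \<approx> w \<Longrightarrow> x @ v @ y \<approx> x @ w @ y"
  by (induction rule: rtranclp_induct)
    (auto dest: braid_step_context[where x = x and y = y] intro: rtranclp.rtrancl_into_rtrancl)

lemma braid_eq_append: "v \<approx> v' \<Longrightarrow> w \<approx> w' \<Longrightarrow> v @ w \<approx> v' @ w'"
  using braid_eq_context[of v v' "[]" w] braid_eq_context[of w w' v' "[]"]
  by (auto intro: braid_eq_trans)

lemma braid_eq_Cons: "v \<approx> w \<Longrightarrow> s # v \<approx> s # w"
  using braid_eq_context[of v w "[s]" "[]"] by simp

lemma braid_step_length: "braid_step v w \<Longrightarrow> length v = length w"
  by (erule braid_step.cases) auto

lemma braid_eq_length: "v \<approx> w \<Longrightarrow> length v = length w"
  by (induction rule: rtranclp_induct) (auto dest: braid_step_length)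

lemma braid_step_rev: "braid_step v w \<Longrightarrow> braid_step (rev v) (rev w)"
proof (erule braid_step.cases)
  fix a b p q
  assume *: "v = p @ alternating (ord a b) a b @ q" "w = p @ alternating (ord a b) b a @ q"
    "{a, b} \<in> J0"
  then show "braid_step (rev v) (rev w)"
    using braid_step[of a b "rev q" "rev p"] braid_step[of b a "rev q" "rev p"]
    by (auto simp: rev_alternating ord_commute[of b a] insert_commute)
qed

lemma braid_eq_rev: "v \<approx> w \<Longrightarrow> rev v \<approx> rev w"
  by (induction rule: rtranclp_induct)
    (auto dest: braid_step_rev intro: rtranclp.rtrancl_into_rtrancl)

lemma braid_relation: "{a, b} \<in> J0 \<Longrightarrow> alternating (ord a b) a b \<approx> alternating (ord a b) b a"
  using braid_step[of a b "[]" "[]"] by auto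

text \<open>In Coxeter group terms: \<open>s\<close> is a left descent of \<open>w\<close>. The letter need not be in front of \<open>w\<close>
  itself.\<close>

definition starts_with :: "'i list \<Rightarrow> 'i \<Rightarrow> bool" where
  "starts_with w s \<longleftrightarrow> (\<exists>v. w \<approx> s # v)"

lemma starts_with_Cons [simp]: "starts_with (s # v) s"
  by (auto simp: starts_with_def)

lemma starts_with_cong: "v \<approx> w \<Longrightarrow> starts_with v s \<longleftrightarrow> starts_with w s"
  unfolding starts_with_def using braid_eq_sym braid_eq_trans by blast

text \<open>By Tits' solution of the word problem this is the usual notion of a reduced word. Taking it as the
  definition keeps the whole development inside words and braid moves.\<close>

definition reduced :: "'i list \<Rightarrow> bool" where
  "reduced w \<longleftrightarrow> (\<forall>p s q. \<not> w \<approx> p @ [s, s] @ q)"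

lemma reduced_cong: "v \<approx> w \<Longrightarrow> reduced v \<longleftrightarrow> reduced w"
  unfolding reduced_def using braid_eq_sym braid_eq_trans by blast

lemma reduced_appendD:
  assumes "reduced (v @ w)" shows "reduced v" "reduced w"
proof -
  have "\<not> v \<approx> p @ [s, s] @ q" for p s q
  proof
    assume "v \<approx> p @ [s, s] @ q"
    from braid_eq_context[OF this, of "[]" w] have "v @ w \<approx> p @ [s, s] @ q @ w" by simp
    then show False using assms unfolding reduced_def by blast
  qed
  then show "reduced v" by (auto simp: reduced_def)
  have "\<not> w \<approx> p @ [s, s] @ q" for p s q
  proof
    assume "w \<approx> p @ [s, s] @ q"
    from braid_eq_context[OF this, of v "[]"] have "v @ w \<approx> (v @ p) @ [s, s] @ q" by simp
    then show False using assms unfolding reduced_def by blast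
  qed
  then show "reduced w" by (auto simp: reduced_def)
qed

lemma reduced_ConsD: "reduced (s # w) \<Longrightarrow> reduced w"
  using reduced_appendD(2)[of "[s]" w] by simp

lemma reduced_Cons_not_starts: "reduced (s # w) \<Longrightarrow> \<not> starts_with w s"
proof
  assume r: "reduced (s # w)" and "starts_with w s"
  then obtain v where "w \<approx> s # v" by (auto simp: starts_with_def)
  from braid_eq_Cons[OF this, of s] have "s # w \<approx> [] @ [s, s] @ v" by simp
  then show False using r unfolding reduced_def by blast
qed

lemma reduced_rev: "reduced (rev w) \<longleftrightarrow> reduced w"
proof -
  have "reduced (rev w)" if "reduced w" for w
    unfolding reduced_def
  proof (intro allI notI)
    fix p s q assume "rev w \<approx> p @ [s, s] @ q"
    from braid_eq_rev[OF this] show False using that by (auto simp: reduced_def)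
  qed
  from this[of w] this[of "rev w"] show ?thesis by auto
qed

section \<open>The dual reflection representation\<close>

text \<open>The matrix of Tits' symmetric bilinear form. For \<open>ord a b = 0\<close> the argument of the cosine is
  \<open>pi / 0 = 0\<close>, so the entry is \<open>- 1\<close>, as it should be for infinite order.\<close>

definition gram :: "'i \<Rightarrow> 'i \<Rightarrow> real" where
  "gram a b = (if a = b then 1 else - cos (pi / ord a b))"

text \<open>The dual of the reflection representation: \<open>f j\<close> is the value of a linear form at the simple root
  \<open>j\<close>. Coordinate \<open>s\<close> tells the side of the wall of \<open>s\<close>, and the positive vectors form
  the fundamental chamber.\<close>

definition reflect :: "'i \<Rightarrow> ('i \<Rightarrow> real) \<Rightarrow> 'i \<Rightarrow> real" where
  "reflect s f = (\<lambda>j. f j - 2 * gram s j * f s)"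

definition act :: "'i list \<Rightarrow> ('i \<Rightarrow> real) \<Rightarrow> 'i \<Rightarrow> real" where
  "act w f = foldr reflect w f"

lemma act_Nil [simp]: "act [] f = f"
  and act_Cons [simp]: "act (s # w) f = reflect s (act w f)"
  and act_append [simp]: "act (v @ w) f = act v (act w f)"
  by (simp_all add: act_def)

lemma reflect_self [simp]: "reflect s f s = - f s"
  by (simp add: reflect_def gram_def)

lemma reflect_reflect [simp]: "reflect s (reflect s f) = f"
  by (auto simp: reflect_def gram_def)

text \<open>Chebyshev polynomials of the second kind with the index shifted by two: for \<open>c = cos t\<close>
  the value at \<open>n\<close> is \<open>sin ((n - 1) * t) / sin t\<close>. The shift makes the value at \<open>0\<close> equal to
  \<open>- 1\<close>, which is needed in \<open>act_alternating\<close> for the empty word. The recursion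
  also covers \<open>c = 1\<close>, where the quotient of sines is meaningless.\<close>

fun chebyshev :: "real \<Rightarrow> nat \<Rightarrow> real" where
  "chebyshev c 0 = - 1"
| "chebyshev c (Suc 0) = 0"
| "chebyshev c (Suc (Suc n)) = 2 * c * chebyshev c (Suc n) - chebyshev c n"

lemma chebyshev_1: "chebyshev 1 n = real n - 1"
  by (induction "1::real" n rule: chebyshev.induct) auto

lemma sin_chebyshev: "sin t * chebyshev (cos t) n = sin ((real n - 1) * t)"
proof (induction "cos t" n rule: chebyshev.induct)
  case (3 n)
  have a: "(1 + real n) * t = real n * t + t" "(real n - 1) * t = real n * t - t"
    by (simp_all add: algebra_simps)
  have "sin t * chebyshev (cos t) (Suc (Suc n)) = 2 * cos t * (sin t * chebyshev (cos t) (Suc n)) - sin t * chebyshev (cos t) n"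
    by (simp add: algebra_simps)
  also have "\<dots> = 2 * cos t * sin (real n * t) - sin ((real n - 1) * t)"
    using 3 by simp
  also have "\<dots> = sin ((1 + real n) * t)"
    unfolding a sin_add sin_diff by (simp add: algebra_simps)
  finally show ?case by (simp add: algebra_simps)
qed auto

lemma chebyshev_pos:
  assumes "N = 0 \<or> n < N" "n \<ge> 1"
  shows "chebyshev (cos (pi / real N)) (Suc n) > 0"
proof (cases "N = 0")
  case True
  then show ?thesis using assms by (simp add: chebyshev_1)
next
  case False
  have N: "N > 1" using assms False by linarith
  have s: "sin (pi / real N) > 0" using N by (intro sin_gt_zero) (auto simp: field_simps)
  have "sin (real n * (pi / real N)) > 0" using assms False N
    by (intro sin_gt_zero) (auto simp: field_simps)
  then have "sin (pi / real N) * chebyshev (cos (pi / real N)) (Suc n) > 0"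
    by (subst sin_chebyshev) simp
  then show ?thesis using s by (simp add: zero_less_mult_iff)
qed

lemma chebyshev_period:
  assumes "N \<ge> 2"
  shows "chebyshev (cos (pi / real N)) N = 1"
    "chebyshev (cos (pi / real N)) (Suc N) = 0"
    "chebyshev (cos (pi / real N)) (Suc (Suc N)) = - 1"
proof -
  let ?t = "pi / real N"
  have s: "sin ?t > 0" using assms by (intro sin_gt_zero) (auto simp: field_simps)
  have "sin ?t * chebyshev (cos ?t) N = sin (pi - ?t)"
    using assms by (subst sin_chebyshev) (simp add: field_simps)
  then show 1: "chebyshev (cos ?t) N = 1" using s by simp
  have "sin ?t * chebyshev (cos ?t) (Suc N) = sin pi"
    using assms by (subst sin_chebyshev) (simp add: field_simps)
  then show 2: "chebyshev (cos ?t) (Suc N) = 0" using s by simp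
  show "chebyshev (cos ?t) (Suc (Suc N)) = - 1" using 1 2 by simp
qed

text \<open>In a dihedral subgroup the two coordinates are combined with rotation coefficients. The letter
  that acts first on \<open>g\<close> is the last letter of the word, so its parity decides which coordinate of
  \<open>g\<close> takes which coefficient.\<close>

lemma act_alternating:
  assumes "a \<noteq> b"
  defines "c \<equiv> cos (pi / ord a b)"
  shows "act (alternating n a b) g b =
           (if odd n then chebyshev c (n + 2) * g a + chebyshev c (n + 1) * g b
            else chebyshev c (n + 2) * g b + chebyshev c (n + 1) * g a)
       \<and> act (alternating n a b) g a =
           (if odd n then - (chebyshev c (n + 1) * g a + chebyshev c n * g b)
            else - (chebyshev c (n + 1) * g b + chebyshev c n * g a))"
  using assms(1) unfolding c_def
proof (induction n arbitrary: a b)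
  case (Suc n)
  have c: "ord b a = ord a b" by (rule ord_commute)
  note IH = Suc.IH[of b a, unfolded c]
  have g: "gram a b = - cos (pi / ord a b)" "gram a a = 1" using Suc.prems by (auto simp: gram_def)
  show ?case using IH Suc.prems
    by (auto simp: reflect_def g algebra_simps)
qed simp

text \<open>Every letter \<open>a\<close> changes the vector by a multiple of row \<open>a\<close> of the Gram matrix. So a word in two
  letters acts on all coordinates through two numbers, and these can be recovered from the two
  coordinates of those letters when the \<open>2 \<times> 2\<close> Gram matrix is invertible.\<close>

lemma act_two_letters:
  assumes "set w \<subseteq> {a, b}"
  shows "\<exists>x y. \<forall>j. act w g j = g j - x * gram a j - y * gram b j"
  using assms
proof (induction w)
  case Nil
  show ?case by (intro exI[of _ 0]) auto
next
  case (Cons s w)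
  then obtain x y where *: "\<And>j. act w g j = g j - x * gram a j - y * gram b j" by auto
  have "s = a \<or> s = b" using Cons by auto
  then show ?case
  proof
    assume "s = a"
    then show ?thesis
      by (intro exI[of _ "x + 2 * act w g s"] exI[of _ y]) (auto simp: reflect_def * algebra_simps)
  next
    assume "s = b"
    then show ?thesis
      by (intro exI[of _ x] exI[of _ "y + 2 * act w g s"]) (auto simp: reflect_def * algebra_simps)
  qed
qed

text \<open>Both sides agree on the coordinates \<open>a\<close> and \<open>b\<close> by the values of the Chebyshev polynomials at a
  half-turn. They agree on the others by \<open>act_two_letters\<close>, since the determinant
  \<open>1 - cos\<^sup>2 (pi / ord a b)\<close> is not zero.\<close>

lemma act_braid_relation:
  assumes "{a, b} \<in> J0"
  shows "act (alternating (ord a b) a b) g = act (alternating (ord a b) b a) g"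
proof -
  let ?N = "ord a b" let ?u = "alternating ?N a b" let ?v = "alternating ?N b a"
  define c where "c = cos (pi / real ?N)"
  have ab: "a \<noteq> b" and N: "?N \<ge> 2" using J0D[OF assms] by auto
  note ch = chebyshev_period[OF N, folded c_def]
  have eq: "act ?u g a = act ?v g a" "act ?u g b = act ?v g b"
    using act_alternating[OF ab, of ?N g] act_alternating[OF ab[symmetric], of ?N g]
      ch by (auto simp: ord_commute[of b a] c_def[symmetric])
  obtain x y where xy: "\<And>j. act ?u g j = g j - x * gram a j - y * gram b j"
    using act_two_letters[of ?u a b g] set_alternating[of ?N a b] by blast
  obtain x' y' where xy': "\<And>j. act ?v g j = g j - x' * gram a j - y' * gram b j"
    using act_two_letters[of ?v a b g] set_alternating[of ?N b a] by blast
  define p q where "p = x - x'" and "q = y - y'"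
  have gr: "gram a b = - c" "gram b a = - c" "gram a a = 1" "gram b b = 1"
    using ab by (auto simp: gram_def c_def ord_commute)
  have "p = q * c" "q = p * c"
    using eq unfolding xy xy' gr p_def q_def by (auto simp: algebra_simps)
  then have pc: "p * (1 - c\<^sup>2) = 0" by (simp add: power2_eq_square algebra_simps)
  have "sin (pi / real ?N) > 0" using N by (intro sin_gt_zero) (auto simp: field_simps)
  then have "1 - c\<^sup>2 \<noteq> 0" using sin_cos_squared_add[of "pi / real ?N"] unfolding c_def
    by (smt (verit) zero_less_power)
  then have "p = 0" "q = 0" using pc \<open>q = p * c\<close> by auto
  then show ?thesis unfolding fun_eq_iff xy xy' p_def q_def by simp
qed

lemma act_braid_eq: "v \<approx> w \<Longrightarrow> act v f = act w f"
proof (induction rule: rtranclp_induct)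
  case (step y z)
  from step(2) have "act y f = act z f"
    by (rule braid_step.cases) (metis act_append act_braid_relation)
  then show ?case using step by simp
qed simp

text \<open>Before a half-turn is completed, the root attached to the next letter \<open>b\<close> is a nonnegative
  combination of the two simple roots, and not zero.\<close>

lemma act_alternating_pos:
  assumes "a \<noteq> b" "ord a b = 0 \<or> n < ord a b" "g a > 0" "g b > 0"
  shows "act (alternating n a b) g b > 0"
proof -
  let ?c = "cos (pi / real (ord a b))"
  have nonneg: "chebyshev ?c (n + 1) \<ge> 0"
    using chebyshev_pos[of "ord a b" n] assms by (cases "n = 0") (auto intro: less_imp_le)
  have "chebyshev ?c (n + 2) > 0 \<or> chebyshev ?c (n + 2) = 0 \<and> chebyshev ?c (n + 1) > 0"
  proof (cases "ord a b = 0 \<or> n + 1 < ord a b")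
    case True
    then show ?thesis using chebyshev_pos[of "ord a b" "Suc n"] by simp
  next
    case False
    then have e: "ord a b = Suc n" "ord a b \<ge> 2"
      using assms J0D(2)[of a b] ord_eq_0[of a b] by auto
    show ?thesis using chebyshev_period[OF e(2)] unfolding e(1) by simp
  qed
  then show ?thesis
    using act_alternating[OF assms(1), of n g] assms(3,4) nonneg
    by (auto intro: add_pos_nonneg add_nonneg_pos)
qed

section \<open>Reduced words\<close>

text \<open>The coset decomposition with respect to the subgroup generated by \<open>s\<close> and \<open>t\<close>: letters \<open>s\<close> and \<open>t\<close>
  are split off from the front as long as possible. As the word is reduced, the letters that are
  split off alternate.\<close>

lemma dihedral_prefix:
  assumes "reduced x" and st: "s \<noteq> t"
  shows "\<exists>n p q v. (p, q) \<in> {(s, t), (t, s)} \<and> x \<approx> alternating n p q @ v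
    \<and> \<not> starts_with v s \<and> \<not> starts_with v t"
  using assms(1)
proof (induction x rule: length_induct)
  case (1 x)
  show ?case
  proof (cases "starts_with x s \<or> starts_with x t")
    case False
    then show ?thesis by (intro exI[of _ 0] exI[of _ s] exI[of _ t] exI[of _ x]) auto
  next
    case True
    then obtain a b y where ab: "(a, b) \<in> {(s, t), (t, s)}" and xy: "x \<approx> a # y"
      by (auto simp: starts_with_def)
    have redy: "reduced (a # y)" using 1(2) reduced_cong[OF xy] by auto
    have len: "length y < length x" using braid_eq_length[OF xy] by simp
    obtain n p q v where n: "(p, q) \<in> {(s, t), (t, s)}" "y \<approx> alternating n p q @ v"
      "\<not> starts_with v s" "\<not> starts_with v t"
      using 1(1) len reduced_ConsD[OF redy] by blast
    have xe: "x \<approx> a # alternating n p q @ v"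
      using xy braid_eq_Cons[OF n(2)] by (rule braid_eq_trans)
    show ?thesis
    proof (cases "n = 0")
      case True
      then show ?thesis using ab n xe
        by (intro exI[of _ 1] exI[of _ a] exI[of _ b] exI[of _ v]) auto
    next
      case False
      then obtain k where k: "n = Suc k" by (cases n) auto
      have "p \<noteq> a"
      proof
        assume "p = a"
        then have "starts_with y a" using n(2) k by (auto simp: starts_with_def)
        then show False using reduced_Cons_not_starts[OF redy] by blast
      qed
      then have "p = b" "q = a" using ab n(1) st by auto
      then show ?thesis using ab n xe
        by (intro exI[of _ "Suc n"] exI[of _ a] exI[of _ b] exI[of _ v]) auto
    qed
  qed
qed

text \<open>Tits' positivity theorem. Let \<open>t\<close> be the first letter of \<open>w\<close> and write \<open>w\<close> as an alternating word
  in \<open>s\<close> and \<open>t\<close> followed by a word \<open>v\<close> that starts with neither. By induction coordinates \<open>s\<close> and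
  \<open>t\<close> of \<open>v f\<close> are positive. The alternating part starts with \<open>t\<close> and is shorter than the
  braid relation, since otherwise that relation would bring \<open>s\<close> to the front. So
  \<open>act_alternating_pos\<close> applies.\<close>

lemma act_pos:
  assumes f: "\<forall>j. f j > 0" and "reduced w" "\<not> starts_with w s"
  shows "act w f s > 0"
  using assms(2,3)
proof (induction w arbitrary: s rule: length_induct)
  case (1 w)
  note IH = 1(1) and red = 1(2) and nst = 1(3)
  show ?case
  proof (cases w)
    case Nil
    then show ?thesis using f by simp
  next
    case (Cons t w')
    then have st: "s \<noteq> t" using nst by auto
    obtain n p q v where pq: "(p, q) \<in> {(s, t), (t, s)}" and we: "w \<approx> alternating n p q @ v"
      and v: "\<not> starts_with v s" "\<not> starts_with v t"
      using dihedral_prefix[OF red st] by blast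
    have "n \<noteq> 0"
    proof
      assume "n = 0"
      then have "w \<approx> v" using we by simp
      then show False using starts_with_cong[of w v t] v Cons by simp
    qed
    then obtain k where k: "n = Suc k" by (cases n) auto
    have p: "p = t" "q = s"
    proof -
      have "p \<noteq> s" using we nst k by (auto simp: starts_with_def)
      then show "p = t" "q = s" using pq by auto
    qed
    have rv: "reduced v" using red reduced_cong[OF we] reduced_appendD(2) by blast
    have "length v < length w" using braid_eq_length[OF we] k by simp
    then have vp: "act v f s > 0" "act v f t > 0" using IH rv v by blast+
    have "ord t s = 0 \<or> n < ord t s"
    proof (rule ccontr)
      assume "\<not> ?thesis"
      then have J: "{t, s} \<in> J0" and N: "ord t s \<le> n" using ord_eq_0[of t s] by auto
      define z where "z = (if even (ord t s) then alternating (n - ord t s) t s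
        else alternating (n - ord t s) s t)"
      have "alternating n t s = alternating (ord t s) t s @ z"
        using alternating_append[of "ord t s" "n - ord t s" t s] N by (simp add: z_def)
      then have "w \<approx> alternating (ord t s) t s @ z @ v" using we p by simp
      then have "w \<approx> alternating (ord t s) s t @ z @ v"
        using braid_eq_context[OF braid_relation[OF J], of "[]" "z @ v"] braid_eq_trans by simp
      moreover obtain l where "ord t s = Suc l" using J0D(2)[OF J] by (cases "ord t s") auto
      ultimately show False using nst by (auto simp: starts_with_def)
    qed
    then have "act (alternating n t s) (act v f) s > 0"
      using act_alternating_pos[of t s n "act v f"] st vp by auto
    then show ?thesis using act_braid_eq[OF we, of f] p by simp
  qed
qed

lemma act_neg:
  assumes f: "\<forall>j. f j > 0" and "reduced w" "starts_with w s"
  shows "act w f s < 0"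
proof -
  obtain v where v: "w \<approx> s # v" using assms(3) by (auto simp: starts_with_def)
  have r: "reduced (s # v)" using assms(2) reduced_cong[OF v] by simp
  have "act v f s > 0"
    using act_pos[OF f, of v s] reduced_ConsD[OF r] reduced_Cons_not_starts[OF r] by simp
  then show ?thesis using act_braid_eq[OF v, of f] by simp
qed

text \<open>The first letter reverses the sign of its own coordinate; hence initial letters and negative
  coordinates are the same thing.\<close>

lemma starts_with_iff:
  assumes f: "\<forall>j. f j > 0" and "reduced w"
  shows "starts_with w s \<longleftrightarrow> act w f s < 0"
proof
  show "starts_with w s \<Longrightarrow> act w f s < 0" by (rule act_neg[OF assms])
  show "act w f s < 0 \<Longrightarrow> starts_with w s" using act_pos[OF assms, of s] by linarith
qed

text \<open>If no relation between \<open>s\<close> and \<open>t\<close> is imposed, then an alternating word in them never completes a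
  half-turn, so the letter that is not at the front of the maximal alternating prefix
  keeps a positive coordinate and cannot be moved to the front.\<close>

lemma reduced_starts_with_both:
  assumes red: "reduced w" and w: "starts_with w s" "starts_with w t" and st: "s \<noteq> t"
  shows "{s, t} \<in> J0"
proof (rule ccontr)
  assume J: "{s, t} \<notin> J0"
  define f where "f = (\<lambda>j::'i. 1::real)"
  have f: "\<forall>j. f j > 0" by (simp add: f_def)
  obtain n p q v where pq: "(p, q) \<in> {(s, t), (t, s)}" and we: "w \<approx> alternating n p q @ v"
    and v: "\<not> starts_with v s" "\<not> starts_with v t"
    using dihedral_prefix[OF red st] by blast
  have o: "ord p q = 0" "p \<noteq> q" using J ord_eq_0 pq st by (auto simp: insert_commute)
  have rv: "reduced v" using red reduced_cong[OF we] reduced_appendD(2) by blast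
  have "act v f p > 0" "act v f q > 0" using act_pos[OF f rv] v pq by auto
  then have "act (alternating n p q) (act v f) q > 0"
    using act_alternating_pos[of p q n "act v f"] o by auto
  then have "act w f q > 0" using act_braid_eq[OF we, of f] by simp
  moreover have "starts_with w q" using w pq by auto
  ultimately show False using act_neg[OF f red] by fastforce
qed

text \<open>Letters act from right to left, and each of them has to reflect the vector from the positive to
  the negative side of its wall. This is reducedness without reference
  to braid moves, which makes it possible to prove that a word is reduced.\<close>

primrec gallery :: "('i \<Rightarrow> real) \<Rightarrow> 'i list \<Rightarrow> bool" where
  "gallery f [] = True"
| "gallery f (s # w) = (act w f s > 0 \<and> gallery f w)"

lemma gallery_append: "gallery f (v @ w) \<longleftrightarrow> gallery f w \<and> gallery (act w f) v"
  by (induction v) auto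

text \<open>Along an alternating word of full length the first and the last crossing already force both
  coordinates of \<open>g\<close> to be positive, and this condition is symmetric in \<open>a\<close> and \<open>b\<close>.\<close>

lemma gallery_braid_relation:
  assumes J: "{a, b} \<in> J0" and g: "gallery g (alternating (ord a b) a b)"
  shows "gallery g (alternating (ord a b) b a)"
proof -
  let ?N = "ord a b"
  obtain k where k: "?N = Suc (Suc k)" using J0D(2)[OF J] that[of "?N - 2"] by simp
  have ab: "a \<noteq> b" using J0D(1)[OF J] .
  note ch = chebyshev_period[OF J0D(2)[OF J]]
  have first: "act (alternating (Suc k) b a) g a > 0" using g k by simp
  have last: "g (if odd ?N then a else b) > 0"
  proof -
    have "alternating ?N a b = alternating (Suc k) a b @ [if odd ?N then a else b]"
      using alternating_append[of "Suc k" "Suc 0" a b] k by auto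
    then show ?thesis using g by (simp add: gallery_append)
  qed
  have "g a > 0" "g b > 0"
    using first last act_alternating[OF ab[symmetric], of "Suc k" g] ch
    unfolding ord_commute[of b a] k add_2_eq_Suc' Suc_eq_plus1[symmetric]
    by (auto split: if_splits)
  then have "n \<le> ?N \<Longrightarrow> gallery g (alternating n x y)" if "(x, y) \<in> {(a, b), (b, a)}" for n x y
    using that
  proof (induction n arbitrary: x y)
    case (Suc n)
    then show ?case using act_alternating_pos[of y x n g] ab
      by (auto simp: ord_commute)
  qed simp
  then show ?thesis by simp
qed

lemma gallery_braid_eq:
  assumes "v \<approx> w" "gallery f v"
  shows "gallery f w"
  using assms
proof (induction rule: rtranclp_induct)
  case (step y z)
  from step(2) show ?case
  proof (cases rule: braid_step.cases)
    case (braid_step a b p q)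
    then show ?thesis
      using step.IH step.prems gallery_braid_relation[of a b "act q f"] act_braid_relation[of a b "act q f"]
      by (simp add: gallery_append)
  qed
qed simp

lemma reduced_iff_gallery:
  assumes f: "\<forall>j. f j > 0"
  shows "reduced w \<longleftrightarrow> gallery f w"
proof
  show "gallery f w" if "reduced w"
    using that
  proof (induction w)
    case (Cons s w)
    then show ?case using act_pos[OF f, of w s] reduced_ConsD reduced_Cons_not_starts by auto
  qed simp
  show "reduced w" if g: "gallery f w"
    unfolding reduced_def
  proof (intro allI notI)
    fix p s q assume "w \<approx> p @ [s, s] @ q"
    from gallery_braid_eq[OF this g] show False by (auto simp: gallery_append)
  qed
qed

text \<open>This is what is left of the exchange condition: the only way in which a letter can destroy
  reducedness is that it is already an initial letter.\<close>

lemma reduced_Cons: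
  assumes "reduced w" "\<not> starts_with w s"
  shows "reduced (s # w)"
  using act_pos[of "\<lambda>_. 1" w s] reduced_iff_gallery[of "\<lambda>_. 1"] assms by auto

text \<open>Reduced words are determined up to braid moves by the chamber that they reach: the signs of the
  coordinates show which letter can be split off from both words.\<close>

lemma act_faithful:
  assumes f: "\<forall>j. f j > 0" and "reduced v" "reduced w" "act v f = act w f"
  shows "v \<approx> w"
  using assms(2-4)
proof (induction v arbitrary: w)
  case Nil
  show ?case
  proof (cases w)
    case (Cons s w')
    then have "starts_with w s" by simp
    then have "act w f s < 0" using act_neg[OF f Nil(2), of s] by blast
    then show ?thesis using Nil(3) spec[OF f, of s] by simp
  qed simp
next
  case (Cons s v)
  have "act w f s < 0" using act_neg[OF f Cons(2), of s] unfolding Cons(4) by simp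
  then have "starts_with w s" using starts_with_iff[OF f Cons(3)] by simp
  then obtain w' where w': "w \<approx> s # w'" by (auto simp: starts_with_def)
  have r: "reduced (s # w')" using Cons(3) reduced_cong[OF w'] by simp
  have "reflect s (act v f) = reflect s (act w' f)"
    using act_braid_eq[OF w', of f] Cons(4) by simp
  then have "act v f = act w' f" by (metis reflect_reflect)
  then have "v \<approx> w'" using Cons(1)[of w'] reduced_ConsD[OF r] reduced_ConsD[OF Cons(2)] by blast
  then show ?case using braid_eq_Cons braid_eq_sym[OF w'] braid_eq_trans by blast
qed

lemma act_cancel: "act u f = act u g \<Longrightarrow> f = g"
proof (induction u)
  case (Cons s u)
  then show ?case by (metis act_Cons reflect_reflect)
qed simp

lemma left_cancel:
  assumes "reduced (u @ v)" "u @ v \<approx> u @ w"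
  shows "v \<approx> w"
proof -
  have "reduced (u @ w)" using assms reduced_cong by blast
  moreover have "act v (\<lambda>_. 1) = act w (\<lambda>_. 1)"
    using act_braid_eq[OF assms(2), of "\<lambda>_. 1"] act_cancel by auto
  ultimately show ?thesis
    using act_faithful[of "\<lambda>_. 1" v w] assms(1) reduced_appendD(2) by auto
qed

lemma right_cancel:
  assumes "reduced (v @ u)" "v @ u \<approx> w @ u"
  shows "v \<approx> w"
proof -
  have "rev v \<approx> rev w"
    using left_cancel[of "rev u" "rev v" "rev w"] assms(1) reduced_rev[of "v @ u"]
      braid_eq_rev[OF assms(2)] by simp
  from braid_eq_rev[OF this] show ?thesis by simp
qed

lemma reflect_uminus: "reflect s (\<lambda>j. - f j) = (\<lambda>j. - reflect s f j)"
  by (auto simp: reflect_def)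

lemma act_uminus: "act w (\<lambda>j. - f j) = (\<lambda>j. - act w f j)"
  by (induction w) (simp_all add: reflect_uminus)

lemma act_rev: "act (rev w) (act w f) = f"
  by (induction w arbitrary: f) auto

text \<open>All coordinates of \<open>t f\<close> are negative, because every letter is initial in \<open>t\<close>. If \<open>w s\<close> is reduced
  and \<open>t = w v\<close>, then \<open>w\<inverse>\<close> maps the positive vector \<open>- t f\<close> to a vector with positive coordinate \<open>s\<close>.
  Therefore coordinate \<open>s\<close> of \<open>v f\<close> is negative, and \<open>v\<close> starts with \<open>s\<close>.\<close>

lemma longest_word_prefix:
  assumes red: "reduced t" and max: "\<And>s. \<not> reduced (s # t)" and "reduced w"
  shows "\<exists>v. w @ v \<approx> t"
  using assms(3)
proof (induction w rule: rev_induct)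
  case Nil
  then show ?case by (intro exI[of _ t]) simp
next
  case (snoc s w)
  define f where "f = (\<lambda>j::'i. 1::real)"
  have f: "\<forall>j. f j > 0" by (simp add: f_def)
  have rw: "reduced w" using snoc.prems reduced_appendD(1) by blast
  obtain v where v: "w @ v \<approx> t" using snoc.IH rw by blast
  have rv: "reduced v" using red reduced_cong[OF v] reduced_appendD(2) by blast
  define g where "g = (\<lambda>j. - act t f j)"
  have g: "\<forall>j. g j > 0"
    using act_neg[OF f red] reduced_Cons[OF red] max by (auto simp: g_def)
  have "reduced (rev (w @ [s]))" using snoc.prems reduced_rev by blast
  then have "reduced (s # rev w)" by simp
  then have "act (rev w) g s > 0" using reduced_iff_gallery[of g] g by auto
  moreover have "act v f = act (rev w) (act t f)"
    using act_braid_eq[OF v, of f] act_rev[of w "act v f"] by simp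
  ultimately have "act v f s < 0" by (simp add: g_def act_uminus)
  then have "starts_with v s" using starts_with_iff[OF f rv] by simp
  then obtain u where u: "v \<approx> s # u" by (auto simp: starts_with_def)
  have "w @ v \<approx> w @ s # u" using braid_eq_context[OF u, of w "[]"] by simp
  then have "(w @ [s]) @ u \<approx> t" using braid_eq_trans[OF braid_eq_sym v] by simp
  then show ?case by blast
qed

lemma longest_word_suffix:
  assumes red: "reduced t" and max: "\<And>s. \<not> reduced (t @ [s])" and "reduced w"
  shows "\<exists>v. v @ w \<approx> t"
proof -
  have "\<not> reduced (s # rev t)" for s using max[of s] reduced_rev[of "t @ [s]"] by simp
  then obtain v where "rev w @ v \<approx> rev t"
    using longest_word_prefix[of "rev t" "rev w"] assms reduced_rev by blast
  from braid_eq_rev[OF this] show ?thesis by auto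
qed

end

section \<open>Nonzero words\<close>

lemma alternating_nth: "t < n \<Longrightarrow> alternating n a b ! t = (if even t then a else b)"
proof (induction n arbitrary: a b t)
  case (Suc n)
  then show ?case by (cases t) auto
qed simp

lemma nth_factor: "t < length u \<Longrightarrow> (x @ u @ y) ! (length x + t) = u ! t"
  by (simp add: nth_append)

lemma set_alternating_eq: "2 \<le> n \<Longrightarrow> set (alternating n a b) = {a, b}"
  by (cases n; cases "n - 1") (use set_alternating[of "n - 2" a b] in \<open>auto simp: numeral_eq_Suc\<close>)

lemma append_eq_append_Cons_avoid:
  assumes "x @ u @ y = p @ i # r" "i \<notin> set u"
  shows "(\<exists>z. x = p @ i # z \<and> r = z @ u @ y) \<or> (\<exists>z. y = z @ i # r \<and> p = x @ u @ z)"
proof -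
  consider (1) z where "x = p @ z" "z @ u @ y = i # r" | (2) z where "x @ z = p" "u @ y = z @ i # r"
    using assms(1) by (auto simp: append_eq_append_conv2)
  then show ?thesis
  proof cases
    case 1
    then show ?thesis using assms(2) by (cases z; cases u) auto
  next
    case 2
    then show ?thesis using assms(2) by (auto simp: append_eq_append_conv2 append_eq_Cons_conv)
  qed
qed

lemma append_Cons_eq_append_Cons:
  assumes "x @ i # z = p @ i # r" "i \<notin> set p"
  shows "(x = p \<and> z = r) \<or> (\<exists>y. x = p @ i # y \<and> r = y @ i # z)"
  using assms by (auto simp: append_eq_append_conv2 append_eq_Cons_conv Cons_eq_append_conv)

lemma mod_4_opposite: "((l + 2) mod 4 < 2) \<noteq> (l mod 4 < (2::nat))"
  by presburger

locale nil_hecke_words = braid_monoid m J0 for m :: "'i \<Rightarrow> 'i \<Rightarrow> enat" and J0 +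
  fixes d :: "'i \<Rightarrow> nat"
  assumes d_ge_2: "2 \<le> d i"
begin

text \<open>Words with a factor that is a monomial relator. A word whose class contains such a
  word represents zero.\<close>

inductive killed :: "'i list \<Rightarrow> bool" where
  power: "killed (p @ replicate (d i) i @ q)"
| braid: "{a, b} \<in> braid_pairs m - J0 \<Longrightarrow> killed (p @ alternating (the_enat (m a b)) a b @ q)"

definition nonzero :: "'i list \<Rightarrow> bool" where
  "nonzero w \<longleftrightarrow> (\<forall>v. w \<approx> v \<longrightarrow> \<not> killed v)"

lemma killed_context: "killed w \<Longrightarrow> killed (x @ w @ y)"
proof (induction rule: killed.cases)
  case (power p i q)
  then show ?case using killed.power[of "x @ p" i "q @ y"] by simp
next
  case (braid a b p q)
  then show ?case using killed.braid[of a b "x @ p" "q @ y"] by simp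
qed

lemma killed_rev: "killed w \<Longrightarrow> killed (rev w)"
proof (induction rule: killed.cases)
  case (power p i q)
  then show ?case using killed.power[of "rev q" i "rev p"] by simp
next
  case (braid a b p q)
  then show ?case
    using killed.braid[of a b "rev q" "rev p"] killed.braid[of b a "rev q" "rev p"]
    by (auto simp: rev_alternating insert_commute m_commute[of b a])
qed

lemma nonzero_cong: "v \<approx> w \<Longrightarrow> nonzero v \<longleftrightarrow> nonzero w"
  unfolding nonzero_def using braid_eq_sym braid_eq_trans by blast

lemma nonzero_factorD: "nonzero (x @ w @ y) \<Longrightarrow> nonzero w"
  unfolding nonzero_def using braid_eq_context killed_context by blast

lemma nonzero_rev: "nonzero (rev w) \<longleftrightarrow> nonzero w"
proof -
  have "nonzero (rev w)" if "nonzero w" for w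
    unfolding nonzero_def
  proof (intro allI impI notI)
    fix v assume "rev w \<approx> v" "killed v"
    then have "w \<approx> rev v" "killed (rev v)" using braid_eq_rev[of "rev w" v] killed_rev by auto
    then show False using that by (auto simp: nonzero_def)
  qed
  from this[of w] this[of "rev w"] show ?thesis by auto
qed

text \<open>Certificate for a nonzero word: a set of words that contains it, is closed under braid moves and
  contains no killed word.\<close>

lemma nonzeroI_closed:
  assumes "P w" "\<And>v v'. P v \<Longrightarrow> braid_step v v' \<Longrightarrow> P v'" "\<And>v. P v \<Longrightarrow> \<not> killed v"
  shows "nonzero w"
proof -
  have "P v" if "w \<approx> v" for v
    using that by (induction rule: rtranclp_induct) (use assms in auto)
  then show ?thesis using assms(3) by (auto simp: nonzero_def)
qed

text \<open>A word without any factor that is a side of a braid relation is alone in its class.\<close>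

lemma nonzero_rigid:
  assumes "\<And>p i q. w \<noteq> p @ replicate (d i) i @ q"
    "\<And>p a b q. {a, b} \<in> braid_pairs m \<Longrightarrow> w \<noteq> p @ alternating (the_enat (m a b)) a b @ q"
  shows "nonzero w"
proof (rule nonzeroI_closed[where P = "\<lambda>v. v = w"])
  show "v' = w" if "v = w" "braid_step v v'" for v v'
    using that(2)
  proof cases
    case (braid_step a b p q)
    then show ?thesis using assms(2)[of a b p q] J0 that(1) by (auto simp: ord_def)
  qed
  show "\<not> killed v" if "v = w" for v
  proof
    assume "killed v"
    then show False by cases (use that assms in blast)+
  qed
qed simp

lemma nonzero_reduced: "nonzero w \<Longrightarrow> \<forall>i. d i = 2 \<Longrightarrow> reduced w"
  unfolding nonzero_def reduced_def using killed.power by (metis numeral_2_eq_2 replicate.simps)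

lemma nonzero_iff_reduced:
  assumes "\<forall>i. d i = 2" "J0 = braid_pairs m"
  shows "nonzero w \<longleftrightarrow> reduced w"
proof
  show "nonzero w" if "reduced w"
    unfolding nonzero_def
  proof (intro allI impI notI)
    fix v assume v: "w \<approx> v" and "killed v"
    from this(2) show False
    proof cases
      case (power p i q)
      then have "w \<approx> p @ [i, i] @ q" using v assms(1) by (simp add: numeral_eq_Suc)
      then show ?thesis using that by (auto simp: reduced_def)
    qed (use assms in auto)
  qed
qed (rule nonzero_reduced[OF _ assms(1)])

lemma factor_nth_rigid:
  assumes "w = p @ u @ q" "length u \<ge> n"
  shows "\<forall>t<n. length p + t < length w \<and> w ! (length p + t) = u ! t"
  using assms nth_factor[of _ u p q] by auto

lemma alternating_factor_letters:
  assumes "w = p @ alternating n a b @ q" "n \<ge> 2" "set w \<subseteq> {i, j}" "a \<noteq> b"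
  shows "(a = i \<and> b = j) \<or> (a = j \<and> b = i)"
  using assms set_alternating_eq[of n a b] by auto

lemma power_factor_nth:
  assumes "w = p @ replicate (d x) x @ q"
  shows "\<forall>t<d x. length p + t < length w \<and> w ! (length p + t) = x"
  using factor_nth_rigid[OF assms, of "d x"] by simp

lemma alternating_factor_nth:
  assumes "w = p @ alternating n a b @ q" "k \<le> n"
  shows "\<forall>t<k. length p + t < length w \<and> w ! (length p + t) = (if even t then a else b)"
  using factor_nth_rigid[OF assms(1), of k] assms(2) alternating_nth[of _ n a b] by auto

lemma enat_ge_the_enat: "enat n \<le> m a b \<Longrightarrow> {a, b} \<in> braid_pairs m \<Longrightarrow> n \<le> the_enat (m a b)"
  using braid_pairsD(4) by (metis enat_ord_simps(1))

section \<open>Long words with a doubled letter\<close>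

text \<open>Powers of \<open>iij\<close> contain alternating factors of length at most 3, so a pair with \<open>m i j \<ge> 4\<close> admits
  no braid move.\<close>

lemma nonzero_iij:
  assumes ij: "i \<noteq> j" and di: "3 \<le> d i" and m: "enat 4 \<le> m i j"
  shows "nonzero (map (\<lambda>p. if p mod 3 = 2 then j else i) [0..<n])" (is "nonzero ?w")
proof (rule nonzero_rigid)
  have nth: "?w ! l = (if l mod 3 = 2 then j else i)" if "l < n" for l using that by simp
  fix p x q
  show "?w \<noteq> p @ replicate (d x) x @ q"
  proof
    assume "?w = p @ replicate (d x) x @ q"
    note f = power_factor_nth[OF this]
    let ?l = "length p"
    show False
    proof (cases "x = i")
      case True
      have "?l < n \<and> (?l mod 3 \<noteq> 2)" "?l + 1 < n \<and> ((?l + 1) mod 3 \<noteq> 2)"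
        "?l + 2 < n \<and> ((?l + 2) mod 3 \<noteq> 2)"
        using f[rule_format, of 0] f[rule_format, of 1] f[rule_format, of 2] nth di True ij
        by (auto split: if_splits)
      then show False by presburger
    next
      case False
      have "?l < n \<and> ?l mod 3 = 2" "?l + 1 < n \<and> (?l + 1) mod 3 = 2"
        using f[rule_format, of 0] f[rule_format, of 1] nth d_ge_2[of x] False
        by (auto split: if_splits)
      then show False by presburger
    qed
  qed
next
  have nth: "?w ! l = (if l mod 3 = 2 then j else i)" if "l < n" for l using that by simp
  fix p a b q
  assume ab: "{a, b} \<in> braid_pairs m"
  show "?w \<noteq> p @ alternating (the_enat (m a b)) a b @ q"
  proof
    assume eq: "?w = p @ alternating (the_enat (m a b)) a b @ q"
    note D = braid_pairsD[OF ab]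
    have *: "(a = i \<and> b = j) \<or> (a = j \<and> b = i)"
      by (rule alternating_factor_letters[OF eq]) (use D in auto)
    then have "4 \<le> the_enat (m a b)" using enat_ge_the_enat[OF _ ab, of 4] m m_commute[of i j] by auto
    note f = alternating_factor_nth[OF eq this]
    let ?l = "length p"
    have "?l + t < n \<and> ((?l + t) mod 3 = 2 \<longleftrightarrow> (if even t then a else b) = j)" if "t < 4" for t
      using f[rule_format, OF that] nth[of "?l + t"] * ij by (auto split: if_splits)
    from this[of 0] this[of 1] this[of 2] this[of 3] show False
      using * ij by (auto; presburger)
  qed
qed

text \<open>Powers of \<open>iijj\<close> contain alternating factors of length at most 2, so no braid relation of order
  at least 3 applies.\<close>

lemma nonzero_iijj:
  assumes ij: "i \<noteq> j" and di: "3 \<le> d i" and dj: "3 \<le> d j" and m: "enat 3 \<le> m i j"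
  shows "nonzero (map (\<lambda>p. if p mod 4 < 2 then i else j) [0..<n])" (is "nonzero ?w")
proof (rule nonzero_rigid)
  have nth: "?w ! l = (if l mod 4 < 2 then i else j)" if "l < n" for l using that by simp
  fix p x q
  show "?w \<noteq> p @ replicate (d x) x @ q"
  proof
    assume eq: "?w = p @ replicate (d x) x @ q"
    note f = power_factor_nth[OF this]
    let ?l = "length p"
    have "x \<in> set ?w" using d_ge_2[of x] by (subst eq) auto
    then have *: "x = i \<or> x = j" by auto
    have "?l + t < n \<and> ((?l + t) mod 4 < 2 \<longleftrightarrow> x = i)" if "t < 3" for t
      using f[rule_format, of t] nth[of "?l + t"] * ij di dj that by (auto split: if_splits)
    from this[of 0] this[of 2] show False using mod_4_opposite[of ?l] by simp
  qed
next
  have nth: "?w ! l = (if l mod 4 < 2 then i else j)" if "l < n" for l using that by simp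
  fix p a b q
  assume ab: "{a, b} \<in> braid_pairs m"
  show "?w \<noteq> p @ alternating (the_enat (m a b)) a b @ q"
  proof
    assume eq: "?w = p @ alternating (the_enat (m a b)) a b @ q"
    note D = braid_pairsD[OF ab]
    have *: "(a = i \<and> b = j) \<or> (a = j \<and> b = i)"
      by (rule alternating_factor_letters[OF eq]) (use D in auto)
    then have "3 \<le> the_enat (m a b)" using enat_ge_the_enat[OF _ ab, of 3] m m_commute[of i j] by auto
    note f = alternating_factor_nth[OF eq this]
    let ?l = "length p"
    have "?l + t < n \<and> ((?l + t) mod 4 < 2 \<longleftrightarrow> (if even t then a else b) = i)" if "t < 3" for t
      using f[rule_format, OF that] nth[of "?l + t"] * ij by (auto split: if_splits)
    from this[of 0] this[of 2] show False using mod_4_opposite[of ?l] by simp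
  qed
qed

text \<open>The letters \<open>j\<close> and \<open>k\<close> may commute, so these words are not rigid. A braid move can only exchange
  the two letters between consecutive double letters \<open>ii\<close>; this preserves the pattern of letters
  modulo 4, which serves as the certificate.\<close>

lemma nonzero_iijk:
  assumes dist: "i \<noteq> j" "i \<noteq> k" "j \<noteq> k" and di: "3 \<le> d i"
    and m: "enat 3 \<le> m i j" "enat 3 \<le> m i k" and jk: "m j k = 2 \<Longrightarrow> {j, k} \<in> J0"
  shows "nonzero (map (\<lambda>p. [i, i, j, k] ! (p mod 4)) [0..<n])" (is "nonzero ?w")
proof -
  define P where "P w \<longleftrightarrow> (\<forall>l<length w. (l mod 4 < 2 \<longrightarrow> w ! l = i) \<and> (l mod 4 \<ge> 2 \<longrightarrow> w ! l \<in> {j, k})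
      \<and> (l mod 4 = 2 \<and> Suc l < length w \<longrightarrow> w ! l \<noteq> w ! Suc l))" for w
  have letters: "set w \<subseteq> {i, j, k}" if "P w" for w
    using that unfolding P_def set_conv_nth by (auto simp: not_less)
  have low: "w ! l = i \<longleftrightarrow> l mod 4 < 2" if "P w" "l < length w" for w l
    using that dist unfolding P_def by (cases "l mod 4 < 2") (auto simp: not_less)
  have fac: "the_enat (m a b) = 2 \<and> {a, b} = {j, k} \<and> length p mod 4 = 2"
    if "P w" "{a, b} \<in> braid_pairs m" and eq: "w = p @ alternating (the_enat (m a b)) a b @ q" for w p a b q
  proof -
    let ?n = "the_enat (m a b)" let ?l = "length p"
    note D = braid_pairsD[OF that(2)]
    have ab: "a \<in> {i, j, k}" "b \<in> {i, j, k}" "a \<noteq> b"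
      using letters[OF that(1)] set_alternating_eq[of ?n a b] D eq by auto
    have ge3: "i \<in> {a, b} \<Longrightarrow> 3 \<le> ?n"
      using ab enat_ge_the_enat[OF _ that(2), of 3] m m_commute by auto
    have lt3: "\<not> 3 \<le> ?n"
    proof
      assume "3 \<le> ?n"
      note f = alternating_factor_nth[OF eq this]
      have "?l + t < length w \<and> ((?l + t) mod 4 < 2 \<longleftrightarrow> (if even t then a else b) = i)" if "t < 3" for t
        using f[rule_format, OF that] low[OF \<open>P w\<close>, of "?l + t"] by simp
      from this[of 0] this[of 2] show False using mod_4_opposite[of ?l] by simp
    qed
    then have n: "?n = 2" and nab: "a \<noteq> i" "b \<noteq> i" using D(3) ge3 by auto
    then have jkab: "{a, b} = {j, k}" using ab by auto
    note f = alternating_factor_nth[OF eq order_refl]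
    have "?l + t < length w \<and> (?l + t) mod 4 \<ge> 2" if "t < 2" for t
      using f[rule_format, of t] n that low[OF \<open>P w\<close>, of "?l + t"] nab by (auto split: if_splits)
    from this[of 0] this[of 1] have "?l mod 4 = 2" by (simp; presburger)
    then show ?thesis using n jkab by simp
  qed
  show ?thesis
  proof (rule nonzeroI_closed[where P = P])
    show "P ?w" unfolding P_def
    proof (intro allI impI)
      fix l assume l: "l < length ?w"
      have "l mod 4 = 0 \<or> l mod 4 = 1 \<or> l mod 4 = 2 \<or> l mod 4 = 3" by presburger
      moreover have "Suc l mod 4 = 3" if "l mod 4 = 2" using that by presburger
      ultimately show "(l mod 4 < 2 \<longrightarrow> ?w ! l = i) \<and> (l mod 4 \<ge> 2 \<longrightarrow> ?w ! l \<in> {j, k})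
          \<and> (l mod 4 = 2 \<and> Suc l < length ?w \<longrightarrow> ?w ! l \<noteq> ?w ! Suc l)"
        using l dist by (elim disjE) (simp_all only: length_map length_upt diff_zero nth_map_upt
            add_0 nth_Cons_0 nth_Cons_numeral One_nat_def nth_Cons_Suc, simp_all)
    qed
  next
    fix v v' assume v: "P v" "braid_step v v'"
    from v(2) show "P v'"
    proof cases
      case (braid_step a b p q)
      have bp: "{a, b} \<in> braid_pairs m" using braid_step J0 by auto
      have o: "ord a b = the_enat (m a b)" using braid_step by (simp add: ord_def)
      have F: "the_enat (m a b) = 2 \<and> {a, b} = {j, k} \<and> length p mod 4 = 2"
        using fac[OF v(1) bp] braid_step(1) o by simp
      have two: "alternating 2 x y = [x, y]" for x y :: 'i by (simp add: numeral_2_eq_2)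
      have e: "v = p @ [a, b] @ q" "v' = p @ [b, a] @ q"
        using braid_step(1,2) unfolding o conjunct1[OF F] two by blast+
      have jk: "a \<in> {j, k}" "b \<in> {j, k}" "a \<noteq> b" using F braid_pairsD(1)[OF bp] by auto
      have nth: "v' ! l = (if l = length p then b else if l = Suc (length p) then a else v ! l)" for l
        unfolding e by (auto simp: nth_append nth_Cons split: nat.split)
      have l2: "length p mod 4 = 2" using F by blast
      then have r: "Suc (length p) mod 4 = 3" by presburger
      show "P v'" unfolding P_def
      proof (intro allI impI)
        fix l assume l: "l < length v'"
        then have "l < length v" by (simp add: e)
        then have "(l mod 4 < 2 \<longrightarrow> v ! l = i) \<and> (l mod 4 \<ge> 2 \<longrightarrow> v ! l \<in> {j, k})
          \<and> (l mod 4 = 2 \<and> Suc l < length v \<longrightarrow> v ! l \<noteq> v ! Suc l)" using v(1) by (auto simp: P_def)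
        moreover have "length v = length v'" by (simp add: e)
        moreover have "l mod 4 = 2 \<Longrightarrow> Suc l \<noteq> length p" using l2 by presburger
        ultimately show "(l mod 4 < 2 \<longrightarrow> v' ! l = i) \<and> (l mod 4 \<ge> 2 \<longrightarrow> v' ! l \<in> {j, k})
          \<and> (l mod 4 = 2 \<and> Suc l < length v' \<longrightarrow> v' ! l \<noteq> v' ! Suc l)"
          unfolding nth using l2 r jk by auto
      qed
    qed
  next
    fix v assume v: "P v"
    show "\<not> killed v"
    proof
      assume "killed v"
      then show False
      proof cases
        case (power p x q)
        note f = power_factor_nth[OF power]
        let ?l = "length p"
        show False
        proof (cases "x = i")
          case True
          have "(?l + t) mod 4 < 2" if "t < 3" for t
            using f[rule_format, of t] that low[OF v, of "?l + t"] di True by simp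
          from this[of 0] this[of 1] this[of 2] show False by (simp; presburger)
        next
          case False
          have *: "?l + t < length v \<and> v ! (?l + t) = x \<and> (?l + t) mod 4 \<ge> 2" if "t < 2" for t
            using f[rule_format, of t] that low[OF v, of "?l + t"] d_ge_2[of x] False by simp
          have "2 \<le> ?l mod 4" "2 \<le> Suc ?l mod 4" using *[of 0] *[of 1] by simp_all
          then have "?l mod 4 = 2" by presburger
          then have "v ! ?l \<noteq> v ! Suc ?l" using v *[of 1] unfolding P_def by auto
          then show False using *[of 0] *[of 1] by simp
        qed
      next
        case (braid a b p q)
        then have F: "the_enat (m a b) = 2" "{a, b} = {j, k}"
          using fac[OF v, of a b p q] by auto
        have "m a b = 2" using braid_pairsD(4)[of a b] braid(2) F(1) by (simp add: numeral_eq_enat)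
        moreover have "m a b = m j k" using F(2) m_commute by (auto simp: doubleton_eq_iff)
        ultimately show False using jk F(2) braid(2) by auto
      qed
    qed
  qed
qed

section \<open>A doubled letter that blocks braid moves\<close>

lemma commute_past:
  assumes "\<forall>e\<in>set c. {i, e} \<in> J0 \<and> ord i e = 2"
  shows "i # c \<approx> c @ [i]"
  using assms
proof (induction c)
  case (Cons e c)
  have "[i, e] \<approx> [e, i]" using braid_relation[of i e] Cons.prems by (simp add: numeral_eq_Suc)
  from braid_eq_context[OF this, of "[]" c] have 1: "i # e # c \<approx> e # i # c" by simp
  have "e # i # c \<approx> e # c @ [i]" using Cons by (intro braid_eq_Cons) auto
  then show ?case using braid_eq_trans[OF 1] by simp
qed simp

text \<open>Two occurrences of \<open>i\<close> that are consecutive among the letters \<open>i\<close> and \<open>j\<close>, with a \<open>j\<close> and no \<open>i\<close>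
  in front of them. A word of this form cannot begin with \<open>i\<close>.\<close>

definition double_letter :: "'i \<Rightarrow> 'i \<Rightarrow> 'i list \<Rightarrow> bool" where
  "double_letter i j w \<longleftrightarrow>
     (\<exists>p c q. w = p @ i # c @ i # q \<and> i \<notin> set p \<and> j \<in> set p \<and> i \<notin> set c \<and> j \<notin> set c)"

lemma double_letterI:
  "w = p @ i # c @ i # q \<Longrightarrow> i \<notin> set p \<Longrightarrow> j \<in> set p \<Longrightarrow> i \<notin> set c \<Longrightarrow> j \<notin> set c \<Longrightarrow>
   double_letter i j w"
  by (auto simp: double_letter_def)

text \<open>A braid move that does not involve \<open>i\<close> stays inside one of the three parts and keeps its set of
  letters. A move of a marked \<open>i\<close> with a letter other than \<open>j\<close> is a commutation, which transports
  that letter into or out of the middle part. A move \<open>jij \<leftrightarrow> iji\<close> could touch the marked pair only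
  as \<open>i\<dots>i j i\<close> starting at the second occurrence. But then the class contains
  \<open>i iji = i jij = iji j = jij j\<close> up to commutations, and this is killed by \<open>d j = 2\<close>.\<close>

lemma double_letter_step:
  assumes ij: "i \<noteq> j"
    and braid_ij: "{i, j} \<in> J0 \<Longrightarrow>
      ord i j = 3 \<and> d j = 2 \<and> (\<forall>e. e \<noteq> i \<longrightarrow> e \<noteq> j \<longrightarrow> {i, e} \<in> J0 \<and> ord i e = 2)"
    and commute: "\<And>e. e \<noteq> j \<Longrightarrow> {i, e} \<in> J0 \<Longrightarrow> ord i e = 2"
    and inv: "double_letter i j v" and nz: "nonzero v" and step: "braid_step v v'"
  shows "double_letter i j v'"
proof -
  obtain p c q where v: "v = p @ i # c @ i # q"
    and pc: "i \<notin> set p" "j \<in> set p" "i \<notin> set c" "j \<notin> set c"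
    using inv by (auto simp: double_letter_def)
  from step obtain a b x y where J: "{a, b} \<in> J0"
    and vx: "v = x @ alternating (ord a b) a b @ y" and v': "v' = x @ alternating (ord a b) b a @ y"
    by (auto elim: braid_step.cases)
  let ?u = "alternating (ord a b) a b" let ?u' = "alternating (ord a b) b a"
  have ab: "a \<noteq> b" "2 \<le> ord a b" using J0D[OF J] by auto
  have su: "set ?u = {a, b}" "set ?u' = {a, b}" using set_alternating_eq[OF ab(2), of a b] set_alternating_eq[OF ab(2), of b a]
    by (simp_all add: insert_commute)
  show ?thesis
  proof (cases "i \<in> {a, b}")
    case False
    have eq: "x @ ?u @ y = p @ i # c @ i # q" using v vx by simp
    have iu: "i \<notin> set ?u" using su False by auto
    consider (1) z where "x = p @ i # z" "c @ i # q = z @ ?u @ y"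
      | (2) z where "y = z @ i # c @ i # q" "p = x @ ?u @ z"
      using append_eq_append_Cons_avoid[OF eq iu] by auto
    then show ?thesis
    proof cases
      case 2
      then show ?thesis using pc su by (intro double_letterI[where p = "x @ ?u' @ z"]) (auto simp: v')
    next
      case 1
      consider (3) t where "z = c @ i # t" "q = t @ ?u @ y" | (4) t where "y = t @ i # q" "c = z @ ?u @ t"
        using append_eq_append_Cons_avoid[of z ?u y c i q] iu 1 by auto
      then show ?thesis
      proof cases
        case 3
        then show ?thesis using pc 1
          by (intro double_letterI[where p = p and c = c and q = "t @ ?u' @ y"]) (auto simp: v')
      next
        case 4
        then show ?thesis using pc 1 su
          by (intro double_letterI[where p = p and c = "z @ ?u' @ t" and q = q]) (auto simp: v')
      qed
    qed
  next
    case True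
    then obtain e where e: "{a, b} = {i, e}" "e \<noteq> i" using ab by auto
    have Je: "{i, e} \<in> J0" using J e by simp
    have oab: "ord a b = ord i e" using e ord_commute by (auto simp: doubleton_eq_iff)
    have cases_ab: "a = i \<and> b = e \<or> a = e \<and> b = i" using e by (auto simp: doubleton_eq_iff)
    show ?thesis
    proof (cases "e = j")
      case False
      then have o: "ord a b = 2" using commute[OF False Je] oab by simp
      from cases_ab show ?thesis
      proof
        assume ie: "a = i \<and> b = e"
        have eq: "x @ i # e # y = p @ i # c @ i # q" using v vx o ie by (simp add: numeral_eq_Suc)
        have w': "v' = x @ e # i # y" using v' o ie by (simp add: numeral_eq_Suc)
        from append_Cons_eq_append_Cons[OF eq pc(1)] show ?thesis
        proof (elim disjE exE conjE)
          assume "x = p" "e # y = c @ i # q"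
          moreover obtain c' where "c = e # c'" using calculation e(2) by (cases c) auto
          ultimately show ?thesis using pc e False
            by (intro double_letterI[where p = "p @ [e]" and c = c' and q = q]) (auto simp: w')
        next
          fix z assume z: "x = p @ i # z" "c @ i # q = z @ i # e # y"
          from append_Cons_eq_append_Cons[OF z(2)[symmetric] pc(3)] show ?thesis
          proof (elim disjE exE conjE)
            assume "z = c" "e # y = q"
            then show ?thesis using pc e z False
              by (intro double_letterI[where p = p and c = "c @ [e]" and q = y]) (auto simp: w')
          next
            fix t assume "z = c @ i # t" "q = t @ i # e # y"
            then show ?thesis using pc z
              by (intro double_letterI[where p = p and c = c and q = "t @ e # i # y"]) (auto simp: w')
          qed
        qed
      next
        assume ie: "a = e \<and> b = i"
        have eq: "(x @ [e]) @ i # y = p @ i # c @ i # q" using v vx o ie by (simp add: numeral_eq_Suc)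
        have w': "v' = x @ i # e # y" using v' o ie by (simp add: numeral_eq_Suc)
        from append_Cons_eq_append_Cons[OF eq pc(1)] show ?thesis
        proof (elim disjE exE conjE)
          assume "x @ [e] = p" "y = c @ i # q"
          then show ?thesis using pc e False
            by (intro double_letterI[where p = x and c = "e # c" and q = q]) (auto simp: w')
        next
          fix z assume z: "x @ [e] = p @ i # z" "c @ i # q = z @ i # y"
          obtain z' where z': "z = z' @ [e]" "x = p @ i # z'" using z(1) e(2)
            by (cases z rule: rev_cases) auto
          from append_Cons_eq_append_Cons[OF z(2)[symmetric] pc(3)] show ?thesis
          proof (elim disjE exE conjE)
            assume "z = c" "y = q"
            then show ?thesis using pc e z'
              by (intro double_letterI[where p = p and c = z' and q = "e # y"]) (auto simp: w')
          next
            fix t assume t: "z = c @ i # t" "q = t @ i # y"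
            then obtain t' where "t = t' @ [e]" "z' = c @ i # t'" using z' e(2)
              by (cases t rule: rev_cases) auto
            then show ?thesis using pc z'
              by (intro double_letterI[where p = p and c = c and q = "t' @ i # e # y"]) (auto simp: w')
          qed
        qed
      qed
    next
      case True
      then have o: "ord a b = 3" and dj: "d j = 2"
        and com: "\<And>e. e \<noteq> i \<Longrightarrow> e \<noteq> j \<Longrightarrow> {i, e} \<in> J0 \<and> ord i e = 2"
        using braid_ij Je oab by auto
      from cases_ab show ?thesis
      proof
        assume ie: "a = i \<and> b = e"
        have eq: "x @ i # j # i # y = p @ i # c @ i # q" using v vx o ie True by (simp add: numeral_eq_Suc)
        have w': "v' = x @ j # i # j # y" using v' o ie True by (simp add: numeral_eq_Suc)
        from append_Cons_eq_append_Cons[OF eq pc(1)] show ?thesis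
        proof (elim disjE exE conjE)
          assume "x = p" "j # i # y = c @ i # q"
          then show ?thesis using pc ij by (cases c) auto
        next
          fix z assume z: "x = p @ i # z" "c @ i # q = z @ i # j # i # y"
          from append_Cons_eq_append_Cons[OF z(2)[symmetric] pc(3)] show ?thesis
          proof (elim disjE exE conjE)
            assume "z = c" "j # i # y = q"
            \<comment> \<open>The first marked \<open>i\<close> is moved next to the second one; the braid relation then
  produces the factor \<open>jj\<close>.\<close>
            then have vv: "v = p @ (i # c) @ i # j # i # y" using v by simp
            have "i # c \<approx> c @ [i]" using pc by (intro commute_past ballI com) auto
            from braid_eq_context[OF this] have 1: "v \<approx> p @ (c @ [i]) @ i # j # i # y" unfolding vv .
            have iji: "[i, j, i] \<approx> [j, i, j]" using braid_relation[of i j] Je True braid_ij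
              by (simp add: numeral_eq_Suc)
            have 2: "p @ (c @ [i]) @ i # j # i # y \<approx> (p @ c) @ [i, j, i] @ j # y"
              using braid_eq_context[OF iji, of "p @ c @ [i]" y] by simp
            have 3: "(p @ c) @ [i, j, i] @ j # y \<approx> (p @ c) @ [j, i, j] @ j # y"
              by (rule braid_eq_context[OF iji])
            have "v \<approx> (p @ c @ [j, i]) @ replicate (d j) j @ y"
              using braid_eq_trans[OF braid_eq_trans[OF 1 2] 3] dj by (simp add: numeral_eq_Suc)
            then have False using nz killed.power unfolding nonzero_def by blast
            then show ?thesis ..
          next
            fix t assume "z = c @ i # t" "q = t @ i # j # i # y"
            then show ?thesis using pc z
              by (intro double_letterI[where p = p and c = c and q = "t @ j # i # j # y"]) (auto simp: w')
          qed
        qed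
      next
        assume ie: "a = e \<and> b = i"
        have eq: "(x @ [j]) @ i # j # y = p @ i # c @ i # q"
          using v vx o ie True by (simp add: numeral_eq_Suc)
        have w': "v' = x @ i # j # i # y" using v' o ie True by (simp add: numeral_eq_Suc)
        from append_Cons_eq_append_Cons[OF eq pc(1)] show ?thesis
        proof (elim disjE exE conjE)
          assume "x @ [j] = p" "j # y = c @ i # q"
          then show ?thesis using pc ij by (cases c) auto
        next
          fix z assume z: "x @ [j] = p @ i # z" "c @ i # q = z @ i # j # y"
          obtain z' where z': "z = z' @ [j]" "x = p @ i # z'" using z(1) ij
            by (cases z rule: rev_cases) auto
          from append_Cons_eq_append_Cons[OF z(2)[symmetric] pc(3)] show ?thesis
          proof (elim disjE exE conjE)
            assume "z = c" "j # y = q"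
            then show ?thesis using pc z' by auto
          next
            fix t assume t: "z = c @ i # t" "q = t @ i # j # y"
            then obtain t' where "t = t' @ [j]" "z' = c @ i # t'" using z' ij
              by (cases t rule: rev_cases) auto
            then show ?thesis using pc z'
              by (intro double_letterI[where p = p and c = c and q = "t' @ i # j # i # y"]) (auto simp: w')
          qed
        qed
      qed
    qed
  qed
qed

lemma double_letter_not_starts:
  assumes "i \<noteq> j"
    and "{i, j} \<in> J0 \<Longrightarrow>
      ord i j = 3 \<and> d j = 2 \<and> (\<forall>e. e \<noteq> i \<longrightarrow> e \<noteq> j \<longrightarrow> {i, e} \<in> J0 \<and> ord i e = 2)"
    and "\<And>e. e \<noteq> j \<Longrightarrow> {i, e} \<in> J0 \<Longrightarrow> ord i e = 2"
    and nz: "nonzero ([j, i, i] @ u)"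
  shows "\<not> starts_with ([j, i, i] @ u) i"
proof
  assume "starts_with ([j, i, i] @ u) i"
  then obtain v where v: "[j, i, i] @ u \<approx> i # v" by (auto simp: starts_with_def)
  have "double_letter i j w \<and> nonzero w" if "[j, i, i] @ u \<approx> w" for w
    using that
  proof (induction rule: rtranclp_induct)
    case base
    have "double_letter i j ([j, i, i] @ u)"
      using assms(1) by (intro double_letterI[where p = "[j]" and c = "[]" and q = u]) auto
    then show ?case using nz by simp
  next
    case (step w w')
    then show ?case
      using double_letter_step[OF assms(1-3), of w w'] nonzero_cong[of w w'] by blast
  qed
  from this[OF v] show False unfolding double_letter_def by (auto simp: Cons_eq_append_conv)
qed

section \<open>Consequences of a socle word\<close>

lemma nonzero_jii:
  assumes ij: "i \<noteq> j" and di: "3 \<le> d i" and m: "enat 3 \<le> m i j"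
  shows "nonzero [j, i, i]"
proof (rule nonzero_rigid)
  fix p x q
  show "[j, i, i] \<noteq> p @ replicate (d x) x @ q"
  proof
    assume eq: "[j, i, i] = p @ replicate (d x) x @ q"
    have "x \<in> set [j, i, i]" using d_ge_2[of x] by (subst eq) auto
    then have "x = i \<or> x = j" by auto
    then show False
    proof
      assume x: "x = i"
      show False
        using power_factor_nth[OF eq, rule_format, of 0] power_factor_nth[OF eq, rule_format, of 2]
          x di ij by auto
    next
      assume x: "x = j"
      have "1 < d x" using d_ge_2[of x] by simp
      note f = power_factor_nth[OF eq, rule_format, OF this]
      have "length p < 2" using f by simp
      then have "length p = 0 \<or> length p = 1" by linarith
      then show False using conjunct2[OF f] x ij by (elim disjE) (simp_all only:, simp_all)
    qed
  qed
next
  fix p a b q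
  assume ab: "{a, b} \<in> braid_pairs m"
  show "[j, i, i] \<noteq> p @ alternating (the_enat (m a b)) a b @ q"
  proof
    assume eq: "[j, i, i] = p @ alternating (the_enat (m a b)) a b @ q"
    note D = braid_pairsD[OF ab]
    have *: "(a = j \<and> b = i) \<or> (a = i \<and> b = j)"
      by (rule alternating_factor_letters[OF eq]) (use D in auto)
    then have "3 \<le> the_enat (m a b)" using enat_ge_the_enat[OF _ ab, of 3] m m_commute[of i j] by auto
    note f = alternating_factor_nth[OF eq this]
    have "length p = 0" using f[rule_format, of 2] by simp
    then show False using f[rule_format, of 0] f[rule_format, of 1] f[rule_format, of 2] * ij by auto
  qed
qed

lemma nonzero_single: "nonzero [a]"
proof (rule nonzero_rigid)
  show "[a] \<noteq> p @ replicate (d x) x @ q" for p x q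
    using d_ge_2[of x] by (auto dest!: arg_cong[where f = length])
  show "[a] \<noteq> p @ alternating (the_enat (m x y)) x y @ q" if "{x, y} \<in> braid_pairs m" for p x y q
    using braid_pairsD(3)[OF that] by (auto dest!: arg_cong[where f = length])
qed

text \<open>The word version of a one-dimensional right socle: every nonzero right ideal that is generated by
  a word contains \<open>t\<close>.\<close>

definition socle_word :: "'i list \<Rightarrow> bool" where
  "socle_word t \<longleftrightarrow> nonzero t \<and> (\<forall>w. nonzero w \<longrightarrow> (\<exists>u. w @ u \<approx> t))"

lemma socle_word_starts:
  assumes "socle_word t" "nonzero (a # w)"
  shows "starts_with t a"
proof -
  obtain u where "(a # w) @ u \<approx> t" using assms by (auto simp: socle_word_def)
  from braid_eq_sym[OF this] show ?thesis by (auto simp: starts_with_def)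
qed

text \<open>The long words above leave only a vertex \<open>i\<close> with a neighbour \<open>j\<close> such that \<open>m i j = 3\<close> and
  \<open>d j = 2\<close>, and, if the braid relation of \<open>i\<close> and \<open>j\<close> is imposed, without further
  neighbours. This is exactly what \<open>double_letter_not_starts\<close> needs for a contradiction, since the
  socle word is a right multiple both of \<open>jii\<close> and of \<open>i\<close>.\<close>

lemma socle_word_exponent:
  assumes irr: "coxeter_irreducible m" and J0_eq: "J0 = braid_pairs_below m k"
    and t: "socle_word t" and bound: "\<And>w. nonzero w \<Longrightarrow> length w \<le> N"
    and i': "i \<noteq> i'"
  shows "d i = 2"
proof (rule ccontr)
  assume "d i \<noteq> 2"
  then have di: "3 \<le> d i" using d_ge_2[of i] by auto
  have J0_iff: "{a, b} \<in> J0 \<longleftrightarrow> a \<noteq> b \<and> m a b < \<infinity> \<and> m a b < k" for a b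
  proof
    assume J: "{a, b} \<in> J0"
    then obtain x y where xy: "{a, b} = {x, y}" "m x y < k" unfolding J0_eq braid_pairs_below_def by auto
    then have "m a b = m x y" using m_commute by (auto simp: doubleton_eq_iff)
    then show "a \<noteq> b \<and> m a b < \<infinity> \<and> m a b < k" using J J0D J0 braid_pairsD(2) xy by auto
  next
    assume "a \<noteq> b \<and> m a b < \<infinity> \<and> m a b < k"
    then show "{a, b} \<in> J0" unfolding J0_eq braid_pairs_below_def braid_pairs_def by blast
  qed
  have two: "m a b = 2 \<or> enat 3 \<le> m a b" if "a \<noteq> b" for a b
  proof -
    have "2 \<le> m a b" using coxeter that by (auto simp: coxeter_matrix_def)
    then show ?thesis by (cases "m a b") (auto simp: numeral_eq_enat)
  qed
  have ord_eq: "ord a b = n" if "{a, b} \<in> J0" "m a b = enat n" for a b n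
    using that by (simp add: ord_def)
  obtain j where j: "3 \<le> m i j"
  proof -
    have "(\<lambda>a b. 3 \<le> m a b)\<^sup>*\<^sup>* i i'" using irr by (auto simp: coxeter_irreducible_def)
    then show ?thesis using i' that by (auto elim: converse_rtranclpE)
  qed
  have mii: "m i i = 1" using coxeter by (auto simp: coxeter_matrix_def)
  have ij: "i \<noteq> j" using j mii by (auto simp: one_enat_def numeral_eq_enat)
  have mij: "enat 3 \<le> m i j" using j by (simp add: numeral_eq_enat)
  have "\<not> enat 4 \<le> m i j"
    using nonzero_iij[OF ij di, of "Suc N"] bound by fastforce
  then have mij3: "m i j = enat 3" using mij by (cases "m i j") auto
  have "\<not> 3 \<le> d j"
    using nonzero_iijj[OF ij di _ mij, of "Suc N"] bound by fastforce
  then have dj: "d j = 2" using d_ge_2[of j] by auto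
  have e2: "{i, e} \<in> J0 \<and> ord i e = 2" if J: "{i, j} \<in> J0" and e: "e \<noteq> i" "e \<noteq> j" for e
  proof -
    have k: "enat 3 < k" using J J0_iff mij3 by auto
    then have small: "{a, b} \<in> J0" if "m a b = 2" "a \<noteq> b" for a b
      using that by (auto simp: J0_iff numeral_eq_enat intro: less_trans[of _ "enat 3"])
    have "\<not> enat 3 \<le> m i e"
      using nonzero_iijk[OF ij e(1)[symmetric] e(2)[symmetric] di mij, of "Suc N"]
        small[of j e] e bound by fastforce
    then have "m i e = 2" using two[of i e] e by auto
    then show ?thesis using small[of i e] e ord_eq[of i e 2] by (auto simp: numeral_eq_enat)
  qed
  have c: "ord i e = 2" if e: "e \<noteq> j" and J: "{i, e} \<in> J0" for e
  proof (cases "{i, j} \<in> J0")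
    case True
    then show ?thesis using e2 e J0D(1)[OF J] by auto
  next
    case False
    then have "k \<le> enat 3" using J0_iff ij mij3 by auto
    moreover have "m i e < k" "i \<noteq> e" using J J0_iff by auto
    ultimately have "m i e = 2" using two[of i e] by auto
    then show ?thesis using ord_eq J by (simp add: numeral_eq_enat)
  qed
  have nz: "nonzero [j, i, i]" using nonzero_jii[OF ij di mij] .
  then obtain u where u: "[j, i, i] @ u \<approx> t" using t by (auto simp: socle_word_def)
  have nzu: "nonzero ([j, i, i] @ u)" using nonzero_cong[OF u] t by (simp add: socle_word_def)
  have "\<not> starts_with ([j, i, i] @ u) i"
    by (rule double_letter_not_starts[OF ij _ c nzu]) (use e2 ord_eq mij3 dj in auto)
  then show False
    using starts_with_cong[OF u] socle_word_starts[OF t nonzero_single[of i]] by simp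
qed

lemma socle_word_braid_pairs:
  assumes "socle_word t" "\<forall>i. d i = 2" "a \<noteq> b"
  shows "{a, b} \<in> J0"
  using reduced_starts_with_both[of t a b] nonzero_reduced[of t] assms
    socle_word_starts[OF assms(1) nonzero_single] by (auto simp: socle_word_def)

lemma nonzero_Nil: "nonzero []"
  using nonzero_factorD[of "[]" "[]" "[undefined]"] nonzero_single by simp

text \<open>Any nonzero word can be extended on the right until no further extension is nonzero. If the
  results are all equivalent, they are equivalent to one fixed word.\<close>

lemma socle_wordI:
  assumes bound: "\<And>w. nonzero w \<Longrightarrow> length w \<le> N"
    and unique: "\<And>v w. nonzero v \<Longrightarrow> nonzero w \<Longrightarrow> \<forall>i. \<not> nonzero (v @ [i]) \<Longrightarrow>
      \<forall>i. \<not> nonzero (w @ [i]) \<Longrightarrow> v \<approx> w"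
  shows "\<exists>t. socle_word t"
proof -
  have extend: "\<exists>u. nonzero (w @ u) \<and> (\<forall>i. \<not> nonzero ((w @ u) @ [i]))" if "nonzero w" for w
  proof -
    have "\<exists>u. nonzero (w @ u) \<and> (\<forall>v. nonzero (w @ v) \<longrightarrow> length v \<le> length u)"
      using ex_has_greatest_nat[of "\<lambda>u. nonzero (w @ u)" "[]" length "Suc N"] that bound
      by (fastforce simp: less_Suc_eq_le)
    then obtain u where u: "nonzero (w @ u)" "\<And>v. nonzero (w @ v) \<Longrightarrow> length v \<le> length u" by blast
    have "\<not> nonzero ((w @ u) @ [i])" for i using u(2)[of "u @ [i]"] by auto
    then show ?thesis using u(1) by blast
  qed
  obtain t where t: "nonzero t" "\<forall>i. \<not> nonzero (t @ [i])"
    using extend[OF nonzero_Nil] by auto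
  have "\<exists>u. w @ u \<approx> t" if "nonzero w" for w
    using extend[OF that] unique t by blast
  then show ?thesis using t(1) by (auto simp: socle_word_def)
qed

section \<open>Words that carry a Frobenius form\<close>

text \<open>The pairing of words \<open>v, w \<mapsto> [v w = t]\<close> is then a perfect matching of the nonzero classes: the first
  condition gives partners, the cancellation conditions make them unique.\<close>

definition frobenius_word :: "'i list \<Rightarrow> bool" where
  "frobenius_word t \<longleftrightarrow> nonzero t
     \<and> (\<forall>w. nonzero w \<longrightarrow> (\<exists>u. w @ u \<approx> t) \<and> (\<exists>u. u @ w \<approx> t))
     \<and> (\<forall>u v w. v @ u \<approx> t \<and> w @ u \<approx> t \<longrightarrow> v \<approx> w)
     \<and> (\<forall>u v w. u @ v \<approx> t \<and> u @ w \<approx> t \<longrightarrow> v \<approx> w)"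

lemma maximal_nonzero_word:
  assumes "\<And>w. nonzero w \<Longrightarrow> length w \<le> N"
  obtains t where "nonzero t" "\<And>w. nonzero w \<Longrightarrow> length w \<le> length t"
proof -
  obtain t where "nonzero t" "\<forall>w. nonzero w \<longrightarrow> length w \<le> length t"
    using ex_has_greatest_nat[of nonzero "[]" length "Suc N"] nonzero_Nil assms
    by (auto simp: less_Suc_eq_le)
  then show ?thesis using that by blast
qed

lemma frobenius_word_coxeter:
  assumes d: "\<forall>i. d i = 2" and J: "J0 = braid_pairs m"
    and bound: "\<And>w. nonzero w \<Longrightarrow> length w \<le> N"
  shows "\<exists>t. frobenius_word t"
proof -
  note red = nonzero_iff_reduced[OF d J]
  obtain t where t: "nonzero t" "\<And>w. nonzero w \<Longrightarrow> length w \<le> length t"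
    using maximal_nonzero_word[OF bound] by blast
  have max: "\<not> reduced (s # t)" "\<not> reduced (t @ [s])" for s
    using t(2)[of "s # t"] t(2)[of "t @ [s]"] by (auto simp: red)
  have rt: "reduced t" using t(1) red by simp
  have "v \<approx> w" if "v @ u \<approx> t" "w @ u \<approx> t" for u v w
    using right_cancel[of v u w] reduced_cong[OF that(1)] rt
      braid_eq_trans[OF that(1) braid_eq_sym[OF that(2)]] by blast
  moreover have "v \<approx> w" if "u @ v \<approx> t" "u @ w \<approx> t" for u v w
    using left_cancel[of u v w] reduced_cong[OF that(1)] rt
      braid_eq_trans[OF that(1) braid_eq_sym[OF that(2)]] by blast
  ultimately have "frobenius_word t" unfolding frobenius_word_def
    using t(1) longest_word_prefix[OF rt max(1)] longest_word_suffix[OF rt max(2)] red by blast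
  then show ?thesis ..
qed

lemma frobenius_word_rank_one:
  assumes one: "\<And>a b :: 'i. a = b"
  shows "\<exists>t. frobenius_word t"
proof -
  define s where "s = (undefined :: 'i)"
  have J: "J0 = {}" using J0D(1) J0 one by (auto simp: braid_pairs_def)
  have rep: "w = replicate (length w) s" for w using one by (metis replicate_length_same)
  have eq: "v \<approx> w \<longleftrightarrow> length v = length w" for v w
    using braid_eq_length rep by (metis rtranclp.rtrancl_refl)
  have nz: "nonzero w \<longleftrightarrow> length w < d s" for w
  proof
    assume nz: "nonzero w"
    show "length w < d s"
    proof (rule ccontr)
      assume "\<not> length w < d s"
      then have "w \<approx> [] @ replicate (d s) s @ replicate (length w - d s) s" by (simp add: eq)
      then show False using nz killed.power unfolding nonzero_def by blast
    qed
  next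
    assume l: "length w < d s"
    show "nonzero w" unfolding nonzero_def
    proof (intro allI impI notI)
      fix v assume v: "w \<approx> v" and "killed v"
      from this(2) have "d s \<le> length v"
      proof cases
        case (power p i q)
        then show ?thesis using one[of i s] by simp
      next
        case (braid a b p q)
        then show ?thesis using braid_pairsD(1)[of a b] one[of a b] by auto
      qed
      then show False using l v eq by simp
    qed
  qed
  \<comment> \<open>The top word is \<open>s\<close> to the power \<open>d s - 1\<close>, the last nonzero power.\<close>
  have "(\<exists>u. length (w @ u) = d s - 1) \<and> (\<exists>u. length (u @ w) = d s - 1)" if "length w < d s" for w :: "'i list"
    by (intro conjI; rule exI[of _ "replicate (d s - 1 - length w) s"]; use that in simp)
  then have "frobenius_word (replicate (d s - 1) s)"
    unfolding frobenius_word_def eq nz using d_ge_2[of s] by auto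
  then show ?thesis ..
qed

end

section \<open>Linear functionals on the free algebra\<close>

definition mon :: "'i list \<Rightarrow> ('i, 'k::field) free_alg" where
  "mon w = Poly_Mapping.single (Word w) 1"

text \<open>The linear extension of a function on words.\<close>

definition functional :: "('i list \<Rightarrow> 'k) \<Rightarrow> ('i, 'k::field) free_alg \<Rightarrow> 'k" where
  "functional \<phi> x = (\<Sum>u\<in>Poly_Mapping.keys x. Poly_Mapping.lookup x u * \<phi> (case u of Word w \<Rightarrow> w))"

lemma functional_superset:
  assumes "finite S" "Poly_Mapping.keys x \<subseteq> S"
  shows "functional \<phi> x = (\<Sum>u\<in>S. Poly_Mapping.lookup x u * \<phi> (case u of Word w \<Rightarrow> w))"
  unfolding functional_def using assms
  by (intro sum.mono_neutral_left) (auto simp: in_keys_iff)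

lemma functional_0 [simp]: "functional \<phi> 0 = 0"
  by (simp add: functional_def)

lemma functional_add: "functional \<phi> (x + y) = functional \<phi> x + functional \<phi> y"
proof -
  let ?S = "Poly_Mapping.keys x \<union> Poly_Mapping.keys y"
  have "Poly_Mapping.keys (x + y) \<subseteq> ?S" by (rule keys_add)
  then show ?thesis
    by (simp add: functional_superset[of ?S] lookup_add sum.distrib algebra_simps)
qed

lemma functional_uminus: "functional \<phi> (- x) = - functional \<phi> x"
  using functional_add[of \<phi> x "- x"] by (simp add: eq_neg_iff_add_eq_0 add.commute)

lemma functional_diff: "functional \<phi> (x - y) = functional \<phi> x - functional \<phi> y"
  using functional_add[of \<phi> x "- y"] by (simp add: functional_uminus)

lemma functional_single [simp]: "functional \<phi> (Poly_Mapping.single (Word w) c) = c * \<phi> w"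
  by (simp add: functional_def)

lemma functional_mon [simp]: "functional \<phi> (mon w) = \<phi> w"
  by (simp add: mon_def)

lemma sum_singles: "(\<Sum>u\<in>Poly_Mapping.keys x. Poly_Mapping.single u (Poly_Mapping.lookup x u)) = x"
  by (rule poly_mapping_eqI) (auto simp: lookup_sum lookup_single when_def in_keys_iff)

lemma free_alg_induct [case_names zero single add]:
  assumes "P 0" "\<And>w c. P (Poly_Mapping.single (Word w) c)" "\<And>x y. P x \<Longrightarrow> P y \<Longrightarrow> P (x + y)"
  shows "P (x :: ('i, 'k::field) free_alg)"
proof -
  have "P (sum f S)" if "\<And>u. P (f u)" for f :: "'i free_monoid \<Rightarrow> ('i, 'k) free_alg" and S
    using assms that by (induction S rule: infinite_finite_induct) auto
  moreover have "P (Poly_Mapping.single u c)" for u c using assms(2) by (cases u) auto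
  ultimately have "P (\<Sum>u\<in>Poly_Mapping.keys x. Poly_Mapping.single u (Poly_Mapping.lookup x u))"
    by simp
  then show ?thesis by (simp only: sum_singles)
qed

lemma functional_mult_right:
  "functional \<phi> (x * Poly_Mapping.single (Word u) c) = c * functional (\<lambda>w. \<phi> (w @ u)) x"
  by (induction x rule: free_alg_induct) (auto simp: mult_single functional_add algebra_simps)

lemma functional_mult_left:
  "functional \<phi> (Poly_Mapping.single (Word u) c * x) = c * functional (\<lambda>w. \<phi> (u @ w)) x"
  by (induction x rule: free_alg_induct) (auto simp: mult_single functional_add algebra_simps)

lemma mon_append: "mon (v @ w) = mon v * mon w"
  by (simp add: mon_def mult_single)

lemma mon_Cons: "mon (i # w) = mon [i] * mon w"
  using mon_append[of "[i]" w] by simp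

lemma mon_Nil: "mon [] = 1"
  by (simp add: mon_def zero_free_monoid_def[symmetric] single_one)

lemma free_gen_mon: "free_gen i = mon [i]"
  by (simp add: free_gen_def mon_def)

lemma prod_list_free_gen: "prod_list (map free_gen w) = mon w"
proof (induction w)
  case (Cons i w)
  then show ?case by (simp add: free_gen_mon mon_Cons[of i w])
qed (simp add: mon_Nil)

lemma free_gen_power: "free_gen i ^ n = mon (replicate n i)"
proof (induction n)
  case (Suc n)
  then show ?case by (simp add: free_gen_mon mon_Cons[of i "replicate n i"])
qed (simp add: mon_Nil)

lemma single_mon: "Poly_Mapping.single (Word w) c = free_scalar c * mon w"
  by (simp add: free_scalar_def mon_def mult_single)

lemma free_scalar_commute: "free_scalar c * x = x * free_scalar c"
  by (induction x rule: free_alg_induct)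
    (auto simp: free_scalar_def mult_single algebra_simps)

lemma free_scalar_add: "free_scalar (a + b) = free_scalar a + free_scalar b"
  by (simp add: free_scalar_def single_add)

lemma free_scalar_0 [simp]: "free_scalar 0 = 0" and free_scalar_1 [simp]: "free_scalar 1 = 1"
  by (simp_all add: free_scalar_def)

lemma functional_scalar: "functional \<phi> (free_scalar c * x) = c * functional \<phi> x"
  using functional_mult_left[of \<phi> "[]" c x] by (simp add: free_scalar_def zero_free_monoid_def)

lemma free_algebra_simps [simp]:
  "carrier free_algebra = UNIV" "mult free_algebra = (*)" "one free_algebra = 1"
  "zero free_algebra = 0" "add free_algebra = (+)"
  by (simp_all add: free_algebra_def)

lemma a_inv_free_algebra [simp]: "\<ominus>\<^bsub>free_algebra\<^esub> x = - (x :: ('i, 'k::field) free_alg)"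
proof -
  interpret ring "free_algebra :: ('i, 'k) free_alg ring" by (rule ring_free_algebra)
  show ?thesis by (rule minus_equality) auto
qed

lemma ideal_free_algebraI:
  fixes I :: "('i, 'k::field) free_alg set"
  assumes "0 \<in> I" "\<And>x y. x \<in> I \<Longrightarrow> y \<in> I \<Longrightarrow> x + y \<in> I" "\<And>x. x \<in> I \<Longrightarrow> - x \<in> I"
    "\<And>x y. x \<in> I \<Longrightarrow> y * x \<in> I" "\<And>x y. x \<in> I \<Longrightarrow> x * y \<in> I"
  shows "ideal I free_algebra"
proof (rule idealI[OF ring_free_algebra])
  interpret ring "free_algebra :: ('i, 'k) free_alg ring" by (rule ring_free_algebra)
  show "subgroup I (add_monoid free_algebra)"
    by (rule add.subgroupI) (use assms in auto)
qed (use assms in auto)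

section \<open>A basis of the nil-Hecke algebra\<close>

text \<open>The type argument fixes the field of scalars, which does not occur in the other parameters.\<close>

locale nil_hecke_alg = nil_hecke_words m J0 d
  for m :: "'i \<Rightarrow> 'i \<Rightarrow> enat" and J0 and d +
  fixes field_type :: "'k::field itself"
begin

abbreviation I :: "('i, 'k) free_alg set" where "I \<equiv> nil_hecke_ideal m d J0"

abbreviation A :: "('i, 'k) free_alg set ring" where "A \<equiv> nil_hecke m d J0"

abbreviation \<eta> :: "'k \<Rightarrow> ('i, 'k) free_alg set" where "\<eta> \<equiv> nil_hecke_scalar m d J0"

abbreviation \<mm> :: "('i, 'k) free_alg set set" where "\<mm> \<equiv> nil_hecke_max_ideal m d J0"

definition proj :: "('i, 'k) free_alg \<Rightarrow> ('i, 'k) free_alg set" where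
  "proj x = I +>\<^bsub>free_algebra\<^esub> x"

text \<open>The coordinate of \<open>x\<close> at the class of \<open>w\<close>. It is well defined on the quotient when \<open>w\<close> is nonzero.\<close>

definition coeff :: "'i list \<Rightarrow> ('i, 'k) free_alg \<Rightarrow> 'k" where
  "coeff w = functional (\<lambda>v. of_bool (v \<approx> w))"

lemma ideal_I: "ideal I free_algebra"
proof -
  interpret ring "free_algebra :: ('i, 'k) free_alg ring" by (rule ring_free_algebra)
  show ?thesis unfolding nil_hecke_ideal_def by (rule genideal_ideal) simp
qed

lemma I_closed:
  "0 \<in> I" "x \<in> I \<Longrightarrow> y \<in> I \<Longrightarrow> x + y \<in> I" "x \<in> I \<Longrightarrow> - x \<in> I" "x \<in> I \<Longrightarrow> y * x \<in> I" "x \<in> I \<Longrightarrow> x * y \<in> I"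
proof -
  interpret ideal I free_algebra by (rule ideal_I)
  show "0 \<in> I" "x \<in> I \<Longrightarrow> y \<in> I \<Longrightarrow> x + y \<in> I" "x \<in> I \<Longrightarrow> - x \<in> I" "x \<in> I \<Longrightarrow> y * x \<in> I" "x \<in> I \<Longrightarrow> x * y \<in> I"
    using additive_subgroup.zero_closed[OF is_additive_subgroup]
      additive_subgroup.a_closed[OF is_additive_subgroup, of x y]
      I_l_closed[of x "- 1"] I_l_closed[of x y] I_r_closed[of x y] by simp_all
qed

lemma I_sum: "(\<And>i. i \<in> S \<Longrightarrow> f i \<in> I) \<Longrightarrow> sum f S \<in> I"
  by (induction S rule: infinite_finite_induct) (auto simp: I_closed)

lemma relators_I: "nil_hecke_relators m d J0 \<subseteq> I"
proof -
  interpret ring "free_algebra :: ('i, 'k) free_alg ring" by (rule ring_free_algebra)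
  show ?thesis unfolding nil_hecke_ideal_def by (rule genideal_self) simp
qed

lemma killed_mon: "killed w \<Longrightarrow> mon w \<in> I"
proof (induction rule: killed.induct)
  case (power p i q)
  have "mon (replicate (d i) i) \<in> I"
    using relators_I unfolding nil_hecke_relators_def free_gen_power by blast
  then show ?case by (simp add: mon_append I_closed)
next
  case (braid a b p q)
  have "mon (alternating (the_enat (m a b)) a b) \<in> I"
    using relators_I braid unfolding nil_hecke_relators_def braid_word_def prod_list_free_gen by blast
  then show ?case by (simp add: mon_append I_closed)
qed

lemma braid_step_mon: "braid_step v w \<Longrightarrow> mon v - mon w \<in> I"
proof (induction rule: braid_step.induct)
  case (braid_step a b p q)
  have o: "ord a b = the_enat (m a b)" "ord a b = the_enat (m b a)"
    using braid_step m_commute[of a b] by (simp_all add: ord_def)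
  have "mon (alternating (the_enat (m a b)) a b) - mon (alternating (the_enat (m b a)) b a) \<in> I"
    using relators_I braid_step unfolding nil_hecke_relators_def braid_word_def prod_list_free_gen by blast
  then have "mon p * (mon (alternating (ord a b) a b) - mon (alternating (ord a b) b a)) * mon q \<in> I"
    using o by (simp add: I_closed)
  then show ?case by (simp add: mon_append algebra_simps)
qed

lemma braid_eq_mon: "v \<approx> w \<Longrightarrow> mon v - mon w \<in> I"
proof (induction rule: rtranclp_induct)
  case base
  then show ?case by (simp add: I_closed)
next
  case (step y z)
  then show ?case using I_closed(2)[OF step.IH braid_step_mon[OF step(2)]] by simp
qed

lemma vanishing_mon: "\<not> nonzero w \<Longrightarrow> mon w \<in> I"
  unfolding nonzero_def using braid_eq_mon killed_mon I_closed(2) by fastforce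

text \<open>The functions on words whose linear extensions vanish on the ideal of relations.\<close>

definition class_function :: "('i list \<Rightarrow> 'k) \<Rightarrow> bool" where
  "class_function \<phi> \<longleftrightarrow> (\<forall>v w. braid_step v w \<longrightarrow> \<phi> v = \<phi> w) \<and> (\<forall>w. killed w \<longrightarrow> \<phi> w = 0)"

lemma class_function_context:
  assumes "class_function \<phi>"
  shows "class_function (\<lambda>w. \<phi> (x @ w))" "class_function (\<lambda>w. \<phi> (w @ y))"
  using assms braid_step_context[where x = x and y = "[]"] braid_step_context[where x = "[]" and y = y]
    killed_context[of _ x "[]"] killed_context[of _ "[]" y]
  unfolding class_function_def by fastforce+

text \<open>The common kernel of the class functions contains the relators. It is an ideal because translating
  a class function by a word on either side gives a class function.\<close>

lemma functional_I:
  assumes "x \<in> I" "class_function \<phi>"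
  shows "functional \<phi> x = 0"
proof -
  define K where "K = {x. \<forall>\<phi>. class_function \<phi> \<longrightarrow> functional \<phi> x = 0}"
  have left: "y * x \<in> K" if "x \<in> K" for x y
    using that by (induction y rule: free_alg_induct)
      (auto simp: K_def algebra_simps functional_add functional_mult_left class_function_context)
  have right: "x * y \<in> K" if "x \<in> K" for x y
    using that by (induction y rule: free_alg_induct)
      (auto simp: K_def algebra_simps functional_add functional_mult_right class_function_context)
  have "ideal K free_algebra"
    by (rule ideal_free_algebraI) (auto simp: left right, auto simp: K_def functional_add functional_uminus)
  moreover have "nil_hecke_relators m d J0 \<subseteq> K"
  proof
    fix x :: "('i, 'k) free_alg" assume "x \<in> nil_hecke_relators m d J0"
    then consider i where "x = mon (replicate (d i) i)"
      | a b where "{a, b} \<in> J0"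
          "x = mon (alternating (the_enat (m a b)) a b) - mon (alternating (the_enat (m b a)) b a)"
      | a b where "{a, b} \<in> braid_pairs m - J0" "x = mon (alternating (the_enat (m a b)) a b)"
      unfolding nil_hecke_relators_def braid_word_def prod_list_free_gen free_gen_power by blast
    then show "x \<in> K"
    proof cases
      case 1
      then show ?thesis using killed.power[of "[]" _ "[]"] by (auto simp: K_def class_function_def)
    next
      case 2
      then have "braid_step (alternating (the_enat (m a b)) a b) (alternating (the_enat (m b a)) b a)"
        using braid_step[of a b "[]" "[]"] m_commute[of b a] by (simp add: ord_def)
      then show ?thesis using 2 by (auto simp: K_def class_function_def functional_diff)
    next
      case 3
      then show ?thesis using killed.braid[of _ _ "[]" "[]"] by (auto simp: K_def class_function_def)
    qed
  qed
  ultimately have "I \<subseteq> K" unfolding nil_hecke_ideal_def by (rule ring.genideal_minimal[OF ring_free_algebra])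
  then show ?thesis using assms by (auto simp: K_def)
qed

lemma class_function_indicator:
  assumes "nonzero w"
  shows "class_function (\<lambda>v. of_bool (v \<approx> w))"
  unfolding class_function_def
proof (intro conjI allI impI)
  fix u v assume "braid_step u v"
  then have "u \<approx> v" "v \<approx> u" using braid_step_sym by auto
  then have "u \<approx> w \<longleftrightarrow> v \<approx> w" using braid_eq_trans by blast
  then show "of_bool (u \<approx> w) = (of_bool (v \<approx> w) :: 'k)" by simp
next
  fix v assume "killed v"
  then have "\<not> v \<approx> w" using assms nonzero_def braid_eq_sym by blast
  then show "of_bool (v \<approx> w) = (0 :: 'k)" by simp
qed

lemma coeff_I: "nonzero w \<Longrightarrow> x \<in> I \<Longrightarrow> coeff w x = 0"
  unfolding coeff_def by (rule functional_I[OF _ class_function_indicator])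

lemma coeff_add: "coeff w (x + y) = coeff w x + coeff w y"
  and coeff_diff: "coeff w (x - y) = coeff w x - coeff w y"
  and coeff_scalar: "coeff w (free_scalar c * x) = c * coeff w x"
  and coeff_mon: "coeff w (mon v) = of_bool (v \<approx> w)"
  by (simp_all add: coeff_def functional_add functional_diff functional_scalar)

text \<open>Modulo the ideal, every word is replaced by zero or by a chosen representative of its class. The
  coefficients of the resulting normal form are the class coordinates.\<close>

lemma coeff_separates:
  assumes "\<And>w. nonzero w \<Longrightarrow> coeff w x = 0"
  shows "x \<in> I"
proof -
  define rep where "rep w = (SOME v. w \<approx> v)" for w
  have rep: "w \<approx> rep w" for w unfolding rep_def by (rule someI[of _ w]) simp
  have rep_cong: "rep v = rep w" if "v \<approx> w" for v w
  proof -
    have "v \<approx> u \<longleftrightarrow> w \<approx> u" for u using that braid_eq_sym braid_eq_trans by blast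
    then show ?thesis by (simp add: rep_def)
  qed
  define nf :: "'i list \<Rightarrow> ('i, 'k) free_alg" where "nf w = (if nonzero w then mon (rep w) else 0)" for w :: "'i list"
  have nf: "mon w - nf w \<in> I" for w
    using vanishing_mon[of w] braid_eq_mon[OF rep, of w] by (simp add: nf_def)
  let ?w = "\<lambda>u. case u of Word w \<Rightarrow> w"
  let ?l = "Poly_Mapping.lookup x" let ?K = "Poly_Mapping.keys x"
  define y where "y = (\<Sum>u\<in>?K. free_scalar (?l u) * nf (?w u))"
  have "x = (\<Sum>u\<in>?K. free_scalar (?l u) * mon (?w u))"
  proof -
    have *: "free_scalar c * mon (?w u) = Poly_Mapping.single u c" for u :: "'i free_monoid" and c :: 'k
      by (cases u) (simp add: single_mon)
    show ?thesis unfolding * by (rule sum_singles[symmetric])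
  qed
  then have "x - y = (\<Sum>u\<in>?K. free_scalar (?l u) * (mon (?w u) - nf (?w u)))"
    by (simp add: y_def sum_subtractf algebra_simps)
  also have "\<dots> \<in> I" by (rule I_sum) (simp add: I_closed nf)
  finally have xy: "x - y \<in> I" .
  have "y = 0"
  proof (rule poly_mapping_eqI)
    fix r :: "'i free_monoid"
    obtain v where v: "r = Word v" by (cases r)
    have lnf: "Poly_Mapping.lookup (free_scalar c * nf w) r = c * of_bool (nonzero w \<and> rep w = v)" for c w
      by (simp add: nf_def v mon_def free_scalar_def mult_single lookup_single when_def)
    have e: "Poly_Mapping.lookup y r = (\<Sum>u\<in>?K. ?l u * of_bool (nonzero (?w u) \<and> rep (?w u) = v))"
      by (simp add: y_def lookup_sum lnf)
    show "Poly_Mapping.lookup y r = Poly_Mapping.lookup 0 r"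
    proof (cases "nonzero v \<and> rep v = v")
      case True
      have "nonzero w \<and> rep w = v \<longleftrightarrow> w \<approx> v" for w
        using True rep[of w] rep_cong[of w v] nonzero_cong[of w v] by auto
      then have "Poly_Mapping.lookup y r = coeff v x" unfolding e coeff_def functional_def by simp
      then show ?thesis using assms True by simp
    next
      case False
      have *: "(nonzero w \<and> rep w = v) = False" for w
        using False rep[of w] rep_cong[of w "rep w"] nonzero_cong[of w v] by auto
      show ?thesis unfolding e * by simp
    qed
  qed
  then show ?thesis using xy by simp
qed

lemma coeff_mult_right: "coeff t (x * mon u) = functional (\<lambda>v. of_bool (v @ u \<approx> t)) x"
  using functional_mult_right[of _ x u 1] by (simp add: coeff_def mon_def)

lemma coeff_mult_left: "coeff t (mon u * x) = functional (\<lambda>v. of_bool (u @ v \<approx> t)) x"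
  using functional_mult_left[of _ u 1 x] by (simp add: coeff_def mon_def)

text \<open>The constant term; its kernel is mapped onto the ideal generated by the letters.\<close>

definition augmentation :: "('i, 'k) free_alg \<Rightarrow> 'k" where
  "augmentation = functional (\<lambda>w. of_bool (w = []))"

lemma ideal_augmentation: "ideal {y. augmentation y = 0} free_algebra"
proof (rule ideal_free_algebraI)
  have zero: "functional (\<lambda>w. 0 :: 'k) x = 0" for x :: "('i, 'k) free_alg"
    by (simp add: functional_def)
  have "augmentation (y * x) = 0 \<and> augmentation (x * y) = 0" if "augmentation x = 0" for x y
    using that
  proof (induction y rule: free_alg_induct)
    case (single w c)
    then show ?case
      by (cases w) (simp_all add: augmentation_def functional_mult_left functional_mult_right zero)
  qed (simp_all add: augmentation_def algebra_simps functional_add)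
  then show "y * x \<in> {y. augmentation y = 0}" "x * y \<in> {y. augmentation y = 0}"
    if "x \<in> {y. augmentation y = 0}" for x y
    using that by auto
qed (auto simp: augmentation_def functional_add functional_uminus)

text \<open>If all letters annihilate \<open>x\<close> from the right, then the algebra acts on \<open>x\<close> from the right through
  the constant term.\<close>

lemma right_augmentation:
  assumes "\<And>i. x * mon [i] \<in> I"
  shows "x * y - free_scalar (augmentation y) * x \<in> I"
proof (induction y rule: free_alg_induct)
  case zero
  then show ?case by (simp add: augmentation_def I_closed)
next
  case (single w c)
  show ?case
  proof (cases w)
    case Nil
    then have "Poly_Mapping.single (Word w) c = free_scalar c"
      by (simp add: free_scalar_def zero_free_monoid_def)
    moreover have "augmentation (Poly_Mapping.single (Word w) c) = c"
      using Nil by (simp add: augmentation_def)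
    ultimately show ?thesis using free_scalar_commute[of c x] by (simp add: I_closed)
  next
    case (Cons i v)
    have "x * Poly_Mapping.single (Word w) c = free_scalar c * (x * mon [i]) * mon v"
      using free_scalar_commute[of c x]
      by (simp add: single_mon Cons mon_Cons[of i v] mult.assoc[symmetric])
    then show ?thesis using assms[of i] by (simp add: augmentation_def Cons I_closed)
  qed
next
  case (add y z)
  then show ?case using I_closed(2)[OF add]
    by (simp add: augmentation_def functional_add free_scalar_add algebra_simps)
qed

lemma left_augmentation:
  assumes "\<And>i. mon [i] * x \<in> I"
  shows "y * x - free_scalar (augmentation y) * x \<in> I"
proof (induction y rule: free_alg_induct)
  case zero
  then show ?case by (simp add: augmentation_def I_closed)
next
  case (single w c)
  show ?case
  proof (cases w rule: rev_cases)
    case Nil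
    then have "Poly_Mapping.single (Word w) c = free_scalar c"
      by (simp add: free_scalar_def zero_free_monoid_def)
    moreover have "augmentation (Poly_Mapping.single (Word w) c) = c"
      using Nil by (simp add: augmentation_def)
    ultimately show ?thesis by (simp add: I_closed)
  next
    case (snoc v i)
    have "Poly_Mapping.single (Word w) c * x = free_scalar c * mon v * (mon [i] * x)"
      by (simp add: single_mon snoc mon_append mult.assoc)
    then show ?thesis using assms[of i] by (simp add: augmentation_def snoc I_closed)
  qed
next
  case (add y z)
  then show ?case using I_closed(2)[OF add]
    by (simp add: augmentation_def functional_add free_scalar_add algebra_simps)
qed

section \<open>Dimensions and primitive elements\<close>

lemma ring_A: "ring A"
  unfolding nil_hecke_def by (rule ideal.quotient_is_ring[OF ideal_I])

lemma proj_hom: "proj \<in> ring_hom free_algebra A"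
proof -
  have "proj = (+>\<^bsub>free_algebra\<^esub>) I" by (simp add: fun_eq_iff proj_def)
  then show ?thesis unfolding nil_hecke_def using ideal.rcos_ring_hom[OF ideal_I] by simp
qed

lemma carrier_A: "carrier A = range proj"
  by (auto simp: nil_hecke_def FactRing_def A_RCOSETS_def' proj_def)

lemma proj_mult: "proj x \<otimes>\<^bsub>A\<^esub> proj y = proj (x * y)"
  and proj_add: "proj x \<oplus>\<^bsub>A\<^esub> proj y = proj (x + y)"
  using ring_hom_mult[OF proj_hom, of x y] ring_hom_add[OF proj_hom, of x y] by simp_all

lemma proj_eq_iff: "proj x = proj y \<longleftrightarrow> x - y \<in> I"
proof -
  interpret ideal I free_algebra by (rule ideal_I)
  have "proj x = proj y \<longleftrightarrow> x \<ominus>\<^bsub>free_algebra\<^esub> y \<in> I"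
    unfolding proj_def using quotient_eq_iff_same_a_r_cos[OF ideal_I, of x y] by simp
  then show ?thesis by (simp add: a_minus_def)
qed

lemma zero_A: "\<zero>\<^bsub>A\<^esub> = proj 0"
proof -
  interpret ring A by (rule ring_A)
  interpret F: ring "free_algebra :: ('i, 'k) free_alg ring" by (rule ring_free_algebra)
  show ?thesis using ring_hom_zero[OF proj_hom F.ring_axioms ring_axioms] by simp
qed

lemma proj_eq_zero_iff: "proj x = \<zero>\<^bsub>A\<^esub> \<longleftrightarrow> x \<in> I"
  by (simp add: zero_A proj_eq_iff)

lemma eta: "\<eta> c = proj (free_scalar c)"
  by (simp add: nil_hecke_scalar_def proj_def)

lemma eta_mult: "\<eta> c \<otimes>\<^bsub>A\<^esub> proj x = proj (free_scalar c * x)"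
  by (simp add: eta proj_mult)

lemma line_extension_A:
  "ring.line_extension A (range \<eta>) (proj x) E = {proj (free_scalar c * x) \<oplus>\<^bsub>A\<^esub> Y | c Y. Y \<in> E}"
proof -
  interpret ring A by (rule ring_A)
  show ?thesis unfolding line_extension_def set_add_def' r_coset_def by (auto simp: eta_mult)
qed

lemma dimension_one_iff:
  "ring.dimension A 1 (range \<eta>) V \<longleftrightarrow> (\<exists>x. x \<notin> I \<and> V = {proj (free_scalar c * x) | c. True})"
proof -
  interpret ring A by (rule ring_A)
  have line: "line_extension (range \<eta>) (proj x) {\<zero>\<^bsub>A\<^esub>} = {proj (free_scalar c * x) | c. True}" for x
    by (auto simp: line_extension_A zero_A proj_add)
  show ?thesis
  proof
    assume "dimension 1 (range \<eta>) V"
    then obtain v E where v: "v \<in> carrier A" "v \<notin> E" "dimension 0 (range \<eta>) E"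
      "V = line_extension (range \<eta>) v E"
      by (auto elim: dimension.cases)
    have E: "E = {\<zero>\<^bsub>A\<^esub>}" using v(3) by (auto elim: dimension.cases)
    obtain x where x: "v = proj x" using v(1) carrier_A by auto
    show "\<exists>x. x \<notin> I \<and> V = {proj (free_scalar c * x) | c. True}"
      using v line E x proj_eq_zero_iff by auto
  next
    assume "\<exists>x. x \<notin> I \<and> V = {proj (free_scalar c * x) | c. True}"
    then obtain x where x: "x \<notin> I" "V = line_extension (range \<eta>) (proj x) {\<zero>\<^bsub>A\<^esub>}"
      using line by auto
    have "dimension (Suc 0) (range \<eta>) V" unfolding x(2)
      by (rule Suc_dim) (use x carrier_A proj_eq_zero_iff in auto)
    then show "dimension 1 (range \<eta>) V" by simp
  qed
qed

lemma dimension_in_carrier_A: "ring.dimension A n (range \<eta>) E \<Longrightarrow> E \<subseteq> carrier A"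
proof -
  interpret ring A by (rule ring_A)
  have K: "range \<eta> \<subseteq> carrier A" using carrier_A eta by auto
  show "E \<subseteq> carrier A" if "dimension n (range \<eta>) E"
    using that
  proof (induction n "range \<eta>" E rule: dimension.induct)
    case (Suc_dim v E n)
    then show ?case using line_extension_in_carrier[OF K] by blast
  qed simp
qed

text \<open>A spanning vector is represented by a polynomial, which involves words of bounded length; braid
  moves preserve length.\<close>

lemma dimension_bounded_length:
  assumes "ring.dimension A n (range \<eta>) E"
  shows "\<exists>N. \<forall>x w. proj x \<in> E \<longrightarrow> nonzero w \<longrightarrow> N < length w \<longrightarrow> coeff w x = 0"
proof -
  interpret ring A by (rule ring_A)
  show ?thesis using assms
  proof (induction n "range \<eta>" E rule: dimension.induct)
    case zero_dim
    then show ?case by (auto simp: proj_eq_zero_iff coeff_I)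
  next
    case (Suc_dim v E n)
    then obtain N where N: "\<And>x w. proj x \<in> E \<Longrightarrow> nonzero w \<Longrightarrow> N < length w \<Longrightarrow> coeff w x = 0"
      by blast
    obtain y where y: "v = proj y" using Suc_dim(1) carrier_A by auto
    \<comment> \<open>A crude bound for the length of the words that occur in \<open>y\<close>.\<close>
    define L where "L = (\<Sum>u\<in>Poly_Mapping.keys y. length (case u of Word w \<Rightarrow> w))"
    have L: "coeff w y = 0" if "L < length w" for w
      unfolding coeff_def functional_def
    proof (intro sum.neutral ballI)
      fix u assume u: "u \<in> Poly_Mapping.keys y"
      have "length (case u of Word w \<Rightarrow> w) \<le> L" unfolding L_def
        by (rule member_le_sum[OF u]) auto
      then have "\<not> (case u of Word w \<Rightarrow> w) \<approx> w" using that braid_eq_length by fastforce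
      then show "Poly_Mapping.lookup y u * of_bool ((case u of Word w \<Rightarrow> w) \<approx> w) = 0" by simp
    qed
    show ?case
    proof (intro exI[of _ "max N L"] allI impI)
      fix x w
      assume x: "proj x \<in> line_extension (range \<eta>) v E" and w: "nonzero w" "max N L < length w"
      obtain c Y where Y: "proj x = proj (free_scalar c * y) \<oplus>\<^bsub>A\<^esub> Y" "Y \<in> E"
        using x unfolding y line_extension_A by blast
      have "E \<subseteq> carrier A"
        using Suc_dim(3) dimension_in_carrier_A by blast
      then obtain z where z: "Y = proj z" using Y(2) carrier_A by auto
      have "x - (free_scalar c * y + z) \<in> I" using Y(1) by (simp add: z proj_add proj_eq_iff)
      from coeff_I[OF w(1) this] have "coeff w x = c * coeff w y + coeff w z"
        by (simp add: coeff_diff coeff_add coeff_scalar)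
      then show "coeff w x = 0" using N[of z w] L[of w] w Y z by simp
    qed
  qed
qed

lemma finite_dimension_bounded_length:
  assumes "ring.finite_dimension A (range \<eta>) (carrier A)"
  obtains N where "\<And>w. nonzero w \<Longrightarrow> length w \<le> N"
proof -
  interpret ring A by (rule ring_A)
  obtain n where "dimension n (range \<eta>) (carrier A)"
    using assms by (auto simp: finite_dimension_def)
  from dimension_bounded_length[OF this] obtain N
    where N: "\<forall>x w. proj x \<in> carrier A \<longrightarrow> nonzero w \<longrightarrow> N < length w \<longrightarrow> coeff w x = 0" by blast
  have "length w \<le> N" if "nonzero w" for w
    using N[rule_format, of "mon w" w] that carrier_A by (force simp: coeff_mon)
  then show ?thesis using that by blast
qed

lemma gen_in_max_ideal: "proj (mon [i]) \<in> \<mm>"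
proof -
  interpret ring A by (rule ring_A)
  have r: "nil_hecke_gen m d J0 i = proj (mon [i])" for i
    by (simp add: nil_hecke_gen_def proj_def free_gen_mon)
  then have "range (nil_hecke_gen m d J0) \<subseteq> carrier A" using carrier_A by auto
  from genideal_self[OF this] show ?thesis
    unfolding nil_hecke_max_ideal_def r[symmetric] by blast
qed

lemma max_ideal_augmentation:
  assumes "Y \<in> \<mm>"
  obtains y where "Y = proj y" "augmentation y = 0"
proof -
  interpret F: ring "free_algebra :: ('i, 'k) free_alg ring" by (rule ring_free_algebra)
  have "ideal (proj ` {y. augmentation y = 0}) A"
  proof -
    have "proj = (+>\<^bsub>free_algebra\<^esub>) I" by (simp add: fun_eq_iff proj_def)
    then show ?thesis unfolding nil_hecke_def
      using F.ring_ideal_imp_quot_ideal[OF ideal_I ideal_augmentation] by simp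
  qed
  moreover have "range (nil_hecke_gen m d J0) \<subseteq> proj ` {y. augmentation y = 0}"
    by (auto simp: nil_hecke_gen_def proj_def free_gen_mon augmentation_def)
  ultimately have "\<mm> \<subseteq> proj ` {y. augmentation y = 0}"
    unfolding nil_hecke_max_ideal_def by (rule ring.genideal_minimal[OF ring_A])
  then show ?thesis using assms that by blast
qed

lemma right_primitive_iff: "proj x \<in> right_primitives A \<mm> \<longleftrightarrow> (\<forall>i. x * mon [i] \<in> I)"
proof
  assume "proj x \<in> right_primitives A \<mm>"
  then have "proj x \<otimes>\<^bsub>A\<^esub> proj (mon [i]) = \<zero>\<^bsub>A\<^esub>" for i
    using gen_in_max_ideal[of i] by (simp add: right_primitives_def)
  then show "\<forall>i. x * mon [i] \<in> I" by (simp add: proj_mult proj_eq_zero_iff)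
next
  assume x: "\<forall>i. x * mon [i] \<in> I"
  have "proj x \<otimes>\<^bsub>A\<^esub> Y = \<zero>\<^bsub>A\<^esub>" if Y: "Y \<in> \<mm>" for Y
  proof -
    obtain y where y: "Y = proj y" "augmentation y = 0" using max_ideal_augmentation[OF Y] .
    have "x * y \<in> I" using right_augmentation[of x y] x y(2) by simp
    then show ?thesis using y proj_mult proj_eq_zero_iff by auto
  qed
  then show "proj x \<in> right_primitives A \<mm>" using carrier_A by (auto simp: right_primitives_def)
qed

lemma left_primitive_iff: "proj x \<in> left_primitives A \<mm> \<longleftrightarrow> (\<forall>i. mon [i] * x \<in> I)"
proof
  assume "proj x \<in> left_primitives A \<mm>"
  then have "proj (mon [i]) \<otimes>\<^bsub>A\<^esub> proj x = \<zero>\<^bsub>A\<^esub>" for i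
    using gen_in_max_ideal[of i] by (simp add: left_primitives_def)
  then show "\<forall>i. mon [i] * x \<in> I" by (simp add: proj_mult proj_eq_zero_iff)
next
  assume x: "\<forall>i. mon [i] * x \<in> I"
  have "Y \<otimes>\<^bsub>A\<^esub> proj x = \<zero>\<^bsub>A\<^esub>" if Y: "Y \<in> \<mm>" for Y
  proof -
    obtain y where y: "Y = proj y" "augmentation y = 0" using max_ideal_augmentation[OF Y] .
    have "y * x \<in> I" using left_augmentation[of x y] x y(2) by simp
    then show ?thesis using y proj_mult proj_eq_zero_iff by auto
  qed
  then show "proj x \<in> left_primitives A \<mm>" using carrier_A by (auto simp: left_primitives_def)
qed

lemma mon_notin_I: "nonzero w \<Longrightarrow> mon w \<notin> I"
  using coeff_I[of w "mon w"] by (auto simp: coeff_mon)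

text \<open>Distinct classes of nonzero words are linearly independent.\<close>

lemma line_words_equal:
  assumes V: "ring.dimension A 1 (range \<eta>) V"
    and "proj (mon v) \<in> V" "proj (mon w) \<in> V" "nonzero v" "nonzero w"
  shows "v \<approx> w"
proof -
  obtain x where x: "V = {proj (free_scalar c * x) | c. True}"
    using V unfolding dimension_one_iff by blast
  obtain b c where bc: "mon v - free_scalar b * x \<in> I" "mon w - free_scalar c * x \<in> I"
    using assms(2,3) x proj_eq_iff by auto
  have "coeff u (mon v) = b * coeff u x" "coeff u (mon w) = c * coeff u x" if "nonzero u" for u
    using coeff_I[OF that bc(1)] coeff_I[OF that bc(2)] by (simp_all add: coeff_diff coeff_scalar)
  from this[OF assms(4)] this[OF assms(5)]
  have "(1::'k) = b * coeff v x" "(1::'k) = c * coeff w x" "of_bool (v \<approx> w) = b * coeff w x"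
    by (simp_all add: coeff_mon)
  then show ?thesis by (cases "v \<approx> w") auto
qed

lemma dimension_one_right_socle_word:
  assumes dim: "ring.dimension A 1 (range \<eta>) (right_primitives A \<mm>)"
    and bound: "\<And>w. nonzero w \<Longrightarrow> length w \<le> N"
  shows "\<exists>t. socle_word t"
proof (rule socle_wordI[OF bound])
  fix v w assume "nonzero v" "nonzero w" "\<forall>i. \<not> nonzero (v @ [i])" "\<forall>i. \<not> nonzero (w @ [i])"
  then show "v \<approx> w"
    by (intro line_words_equal[OF dim]) (auto simp: right_primitive_iff vanishing_mon simp flip: mon_append)
qed

lemma dimension_one_left_socle_word:
  assumes dim: "ring.dimension A 1 (range \<eta>) (left_primitives A \<mm>)"
    and bound: "\<And>w. nonzero w \<Longrightarrow> length w \<le> N"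
  shows "\<exists>t. socle_word t"
proof (rule socle_wordI[OF bound])
  fix v w assume *: "nonzero v" "nonzero w" "\<forall>i. \<not> nonzero (v @ [i])" "\<forall>i. \<not> nonzero (w @ [i])"
  have "\<not> nonzero ([i] @ rev v)" "\<not> nonzero ([i] @ rev w)" for i
    using * nonzero_rev[of "v @ [i]"] nonzero_rev[of "w @ [i]"] by auto
  then have "rev v \<approx> rev w"
    using *(1,2) by (intro line_words_equal[OF dim])
      (auto simp: left_primitive_iff vanishing_mon nonzero_rev simp flip: mon_append)
  from braid_eq_rev[OF this] show "v \<approx> w" by simp
qed

section \<open>Frobenius forms\<close>

context
  fixes t assumes t: "frobenius_word t"
begin

text \<open>Multiplication by the unique partner \<open>u\<close> of \<open>w\<close> turns the coefficient at \<open>w\<close> into the coefficient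
  at \<open>t\<close>. This makes the form nondegenerate and shows that a right-primitive element has no
  coefficient away from \<open>t\<close>.\<close>

lemma coeff_top_right:
  assumes "w @ u \<approx> t" shows "coeff t (x * mon u) = coeff w x"
proof -
  have "v @ u \<approx> t \<longleftrightarrow> v \<approx> w" for v
    using t assms braid_eq_append[of v w u u] braid_eq_trans[of "v @ u" "w @ u" t]
    unfolding frobenius_word_def by blast
  then show ?thesis unfolding coeff_mult_right by (simp add: coeff_def)
qed

lemma coeff_top_left:
  assumes "u @ w \<approx> t" shows "coeff t (mon u * x) = coeff w x"
proof -
  have "u @ v \<approx> t \<longleftrightarrow> v \<approx> w" for v
    using t assms braid_eq_append[of u u v w] braid_eq_trans[of "u @ v" "u @ w" t]
    unfolding frobenius_word_def by blast
  then show ?thesis unfolding coeff_mult_left by (simp add: coeff_def)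
qed

lemma not_top_imp_multiple:
  assumes "\<And>w. nonzero w \<Longrightarrow> \<not> w \<approx> t \<Longrightarrow> coeff w x = 0"
  shows "x - free_scalar (coeff t x) * mon t \<in> I"
proof (rule coeff_separates)
  fix w assume w: "nonzero w"
  show "coeff w (x - free_scalar (coeff t x) * mon t) = 0"
  proof (cases "w \<approx> t")
    case True
    have "v \<approx> w \<longleftrightarrow> v \<approx> t" for v using True braid_eq_sym braid_eq_trans by blast
    then have "coeff w y = coeff t y" for y by (simp add: coeff_def)
    then show ?thesis using braid_eq_sym[OF True] by (simp add: coeff_diff coeff_scalar coeff_mon)
  next
    case False
    then have "\<not> t \<approx> w" using braid_eq_sym by blast
    then show ?thesis using assms[OF w False] by (simp add: coeff_diff coeff_scalar coeff_mon)
  qed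
qed

lemma top_extension_vanishes: "\<not> nonzero (t @ [i])" "\<not> nonzero ([i] @ t)"
proof -
  have "nonzero w \<Longrightarrow> length w \<le> length t" for w
    using t braid_eq_length unfolding frobenius_word_def by (metis le_add1 length_append)
  from this[of "t @ [i]"] this[of "[i] @ t"] show "\<not> nonzero (t @ [i])" "\<not> nonzero ([i] @ t)" by auto
qed

lemma top_primitives:
  "right_primitives A \<mm> = {proj (free_scalar c * mon t) | c. True}"
  "left_primitives A \<mm> = {proj (free_scalar c * mon t) | c. True}"
proof -
  let ?L = "{proj (free_scalar c * mon t) | c. True}"
  have multiple: "proj x \<in> ?L" if "\<And>w. nonzero w \<Longrightarrow> \<not> w \<approx> t \<Longrightarrow> coeff w x = 0" for x
    using not_top_imp_multiple[of x] that proj_eq_iff by blast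
  have nt: "nonzero t" using t by (simp add: frobenius_word_def)
  have "X \<in> ?L" if X: "X \<in> right_primitives A \<mm>" for X
  proof -
    obtain x where x: "X = proj x" using X carrier_A by (auto simp: right_primitives_def)
    have xi: "x * mon [i] \<in> I" for i using X x right_primitive_iff by auto
    have "coeff w x = 0" if w: "nonzero w" "\<not> w \<approx> t" for w
    proof -
      obtain u where u: "w @ u \<approx> t" using t w(1) unfolding frobenius_word_def by blast
      obtain i u' where iu: "u = i # u'" using u w(2) by (cases u) auto
      have "x * mon u \<in> I" using I_closed(5)[OF xi[of i], of "mon u'"]
        by (simp add: iu mon_Cons[of i u'] mult.assoc)
      then show ?thesis using coeff_I[OF nt] coeff_top_right[OF u, of x] by simp
    qed
    then show ?thesis using multiple x by blast
  qed
  moreover have "X \<in> ?L" if X: "X \<in> left_primitives A \<mm>" for X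
  proof -
    obtain x where x: "X = proj x" using X carrier_A by (auto simp: left_primitives_def)
    have xi: "mon [i] * x \<in> I" for i using X x left_primitive_iff by auto
    have "coeff w x = 0" if w: "nonzero w" "\<not> w \<approx> t" for w
    proof -
      obtain u where u: "u @ w \<approx> t" using t w(1) unfolding frobenius_word_def by blast
      obtain i u' where iu: "u = u' @ [i]" using u w(2) by (cases u rule: rev_cases) auto
      have "mon u * x \<in> I" using I_closed(4)[OF xi[of i], of "mon u'"]
        by (simp add: iu mon_append mult.assoc)
      then show ?thesis using coeff_I[OF nt] coeff_top_left[OF u, of x] by simp
    qed
    then show ?thesis using multiple x by blast
  qed
  moreover have "free_scalar c * mon t * mon [i] \<in> I" for c i
    using I_closed(4)[OF vanishing_mon[OF top_extension_vanishes(1)[of i]], of "free_scalar c"]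
    by (simp add: mon_append mult.assoc)
  moreover have "mon [i] * (free_scalar c * mon t) \<in> I" for c i
    using I_closed(4)[OF vanishing_mon[OF top_extension_vanishes(2)[of i]], of "free_scalar c"]
      free_scalar_commute[of c "mon [i]"]
    by (simp add: mon_Cons[of i t] mult.assoc[symmetric])
  ultimately show "right_primitives A \<mm> = ?L" "left_primitives A \<mm> = ?L"
    using right_primitive_iff left_primitive_iff by auto
qed

lemma dimension_one_top: "ring.dimension A 1 (range \<eta>) {proj (free_scalar c * mon t) | c. True}"
  using mon_notin_I[of t] t unfolding dimension_one_iff frobenius_word_def by blast

lemma frobenius_top:
  assumes "ring.finite_dimension A (range \<eta>) (carrier A)"
  shows "frobenius_algebra A \<eta>"
proof -
  interpret ring A by (rule ring_A)
  have nt: "nonzero t" using t by (simp add: frobenius_word_def)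
  \<comment> \<open>The coefficient at \<open>t\<close>, read off from an arbitrary representative of the coset.\<close>
  define \<tau> where "\<tau> X = coeff t (SOME x. X = proj x)" for X
  have tau: "\<tau> (proj x) = coeff t x" for x
  proof -
    have "proj x = proj (SOME y. proj x = proj y)" by (rule someI) simp
    then have "x - (SOME y. proj x = proj y) \<in> I" by (simp only: proj_eq_iff)
    then show ?thesis using coeff_I[OF nt] by (fastforce simp: \<tau>_def coeff_diff)
  qed
  define \<sigma> where "\<sigma> X Y = \<tau> (X \<otimes>\<^bsub>A\<^esub> Y)" for X Y
  have sigma: "\<sigma> (proj x) (proj y) = coeff t (x * y)" for x y by (simp add: \<sigma>_def proj_mult tau)
  have scalar: "x * (free_scalar c * y) = free_scalar c * (x * y)" for x y :: "('i, 'k) free_alg" and c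
    using free_scalar_commute[of c x] by (simp add: mult.assoc[symmetric])
  have "bilinear_form A \<eta> \<sigma>"
    unfolding bilinear_form_def carrier_A
    by (auto simp: sigma proj_add eta_mult algebra_simps coeff_add coeff_scalar scalar)
  moreover have "nondegenerate_form A \<sigma>"
    unfolding nondegenerate_form_def
  proof (intro conjI ballI impI)
    fix X assume X: "X \<in> carrier A" "\<forall>Y\<in>carrier A. \<sigma> X Y = 0"
    then obtain x where x: "X = proj x" using carrier_A by auto
    have "x \<in> I"
    proof (rule coeff_separates)
      fix w assume "nonzero w"
      then obtain u where "w @ u \<approx> t" using t unfolding frobenius_word_def by blast
      from coeff_top_right[OF this, of x] show "coeff w x = 0"
        using X(2) sigma[of x "mon u"] carrier_A x by auto
    qed
    then show "X = \<zero>\<^bsub>A\<^esub>" using x proj_eq_zero_iff by simp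
  next
    fix Y assume Y: "Y \<in> carrier A" "\<forall>X\<in>carrier A. \<sigma> X Y = 0"
    then obtain y where y: "Y = proj y" using carrier_A by auto
    have "y \<in> I"
    proof (rule coeff_separates)
      fix w assume "nonzero w"
      then obtain u where "u @ w \<approx> t" using t unfolding frobenius_word_def by blast
      from coeff_top_left[OF this, of y] show "coeff w y = 0"
        using Y(2) sigma[of "mon u" y] carrier_A y by auto
    qed
    then show "Y = \<zero>\<^bsub>A\<^esub>" using y proj_eq_zero_iff by simp
  qed
  ultimately show ?thesis using assms unfolding frobenius_algebra_def
    by (intro conjI exI[of _ \<sigma>]) (auto simp: \<sigma>_def m_assoc)
qed

end

text \<open>For right-primitive \<open>x\<close> the form satisfies \<open>\<sigma> x y = \<sigma> (x y) 1 = \<epsilon> y * \<sigma> x 1\<close>, so \<open>x \<mapsto> \<sigma> x 1\<close> is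
  injective on the right-primitive elements. Any nonzero word of maximal length provides a nonzero one.\<close>

lemma frobenius_dimension_one:
  assumes frob: "frobenius_algebra A \<eta>" and bound: "\<And>w. nonzero w \<Longrightarrow> length w \<le> N"
  shows "ring.dimension A 1 (range \<eta>) (right_primitives A \<mm>)"
proof -
  interpret ring A by (rule ring_A)
  obtain \<sigma> where bil: "bilinear_form A \<eta> \<sigma>" and nondeg: "nondegenerate_form A \<sigma>"
    and assoc: "\<And>a b c. a \<in> carrier A \<Longrightarrow> b \<in> carrier A \<Longrightarrow> c \<in> carrier A \<Longrightarrow>
      \<sigma> (a \<otimes>\<^bsub>A\<^esub> b) c = \<sigma> a (b \<otimes>\<^bsub>A\<^esub> c)"
    using frob unfolding frobenius_algebra_def by blast
  obtain t where t: "nonzero t" "\<And>w. nonzero w \<Longrightarrow> length w \<le> length t"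
    using maximal_nonzero_word[OF bound] by blast
  have add: "\<sigma> (proj x \<oplus>\<^bsub>A\<^esub> proj y) (proj z) = \<sigma> (proj x) (proj z) + \<sigma> (proj y) (proj z)"
    and scal: "\<sigma> (\<eta> c \<otimes>\<^bsub>A\<^esub> proj x) (proj y) = c * \<sigma> (proj x) (proj y)" for x y z c
    using bil carrier_A unfolding bilinear_form_def by auto
  have kill: "x \<in> I" if x: "\<And>i. x * mon [i] \<in> I" and 1: "\<sigma> (proj x) (proj 1) = 0" for x
  proof -
    have "\<sigma> (proj x) (proj y) = 0" for y
    proof -
      have "\<sigma> (proj x) (proj y) = \<sigma> (proj x) (proj y \<otimes>\<^bsub>A\<^esub> proj 1)" by (simp add: proj_mult)
      also have "\<dots> = \<sigma> (proj x \<otimes>\<^bsub>A\<^esub> proj y) (proj 1)" using assoc carrier_A by auto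
      also have "proj x \<otimes>\<^bsub>A\<^esub> proj y = \<eta> (augmentation y) \<otimes>\<^bsub>A\<^esub> proj x"
        using right_augmentation[OF x, of y] by (simp add: proj_mult eta_mult proj_eq_iff)
      finally show ?thesis using scal 1 by simp
    qed
    then show ?thesis using nondeg carrier_A proj_eq_zero_iff unfolding nondegenerate_form_def by auto
  qed
  have ti: "mon t * mon [i] \<in> I" for i
    using vanishing_mon[of "t @ [i]"] t(2)[of "t @ [i]"] by (auto simp: mon_append)
  define s where "s = \<sigma> (proj (mon t)) (proj 1)"
  have s: "s \<noteq> 0" using kill[OF ti] mon_notin_I[OF t(1)] s_def by auto
  have "right_primitives A \<mm> = {proj (free_scalar c * mon t) | c. True}"
  proof (intro equalityI subsetI)
    fix X assume X: "X \<in> right_primitives A \<mm>"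
    then obtain x where x: "X = proj x" using carrier_A by (auto simp: right_primitives_def)
    have xi: "x * mon [i] \<in> I" for i using X x right_primitive_iff by auto
    define c where "c = \<sigma> (proj x) (proj 1) / s"
    \<comment> \<open>The constant is chosen so that the form pairs the difference with 1 to zero.\<close>
    let ?y = "x + free_scalar (- c) * mon t"
    have "?y \<in> I"
    proof (rule kill)
      show "?y * mon [i] \<in> I" for i
        using I_closed(2)[OF xi[of i] I_closed(4)[OF ti[of i], of "free_scalar (- c)"]]
        by (simp add: algebra_simps mult.assoc)
      have "\<sigma> (proj ?y) (proj 1) = \<sigma> (proj x \<oplus>\<^bsub>A\<^esub> \<eta> (- c) \<otimes>\<^bsub>A\<^esub> proj (mon t)) (proj 1)"
        by (simp add: proj_add eta_mult)
      also have "\<dots> = \<sigma> (proj x) (proj 1) - c * s"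
        using add[of x "free_scalar (- c) * mon t" 1] scal[of "- c" "mon t" 1]
        by (simp add: eta_mult s_def)
      finally show "\<sigma> (proj ?y) (proj 1) = 0" using s by (simp add: c_def)
    qed
    moreover have "free_scalar (- c) = - (free_scalar c :: ('i, 'k) free_alg)"
      by (simp add: free_scalar_def single_uminus)
    ultimately have "proj x = proj (free_scalar c * mon t)" by (simp add: proj_eq_iff)
    then show "X \<in> {proj (free_scalar c * mon t) | c. True}" using x by blast
  next
    fix X assume "X \<in> {proj (free_scalar c * mon t) | c. True}"
    then obtain c where c: "X = proj (free_scalar c * mon t)" by blast
    have "free_scalar c * mon t * mon [i] \<in> I" for i
      using I_closed(4)[OF ti[of i], of "free_scalar c"] by (simp add: mult.assoc)
    then show "X \<in> right_primitives A \<mm>" using c right_primitive_iff by auto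
  qed
  then show ?thesis using mon_notin_I[OF t(1)] unfolding dimension_one_iff by blast
qed

end

section \<open>The characterization\<close>

lemma braid_pairs_below_iff:
  assumes "coxeter_matrix m"
  shows "{a, b} \<in> braid_pairs_below m k \<longleftrightarrow> a \<noteq> b \<and> m a b < \<infinity> \<and> m a b < k"
proof
  assume "{a, b} \<in> braid_pairs_below m k"
  then obtain x y where xy: "{a, b} = {x, y}" "m x y < k" "{a, b} \<in> braid_pairs m"
    by (auto simp: braid_pairs_below_def)
  then obtain p q where "{a, b} = {p, q}" "p \<noteq> q" "m p q < \<infinity>" unfolding braid_pairs_def by blast
  with xy(1,2) show "a \<noteq> b \<and> m a b < \<infinity> \<and> m a b < k"
    using assms by (auto simp: coxeter_matrix_def doubleton_eq_iff)
next
  assume *: "a \<noteq> b \<and> m a b < \<infinity> \<and> m a b < k"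
  then have "{a, b} \<in> braid_pairs m" unfolding braid_pairs_def by blast
  with * show "{a, b} \<in> braid_pairs_below m k" unfolding braid_pairs_below_def by blast
qed

theorem theorem6:
  fixes m :: "'i::finite \<Rightarrow> 'i \<Rightarrow> enat"
    and d :: "'i \<Rightarrow> nat"
    and k :: enat
    and A :: "('i, 'k::field) free_alg set ring"
    and \<eta> :: "'k \<Rightarrow> ('i, 'k) free_alg set"
    and \<mm> :: "('i, 'k) free_alg set set"
    and case_a case_b :: bool
  defines "A \<equiv> nil_hecke m d (braid_pairs_below m k)"
    and "\<eta> \<equiv> nil_hecke_scalar m d (braid_pairs_below m k)"
    and "\<mm> \<equiv> nil_hecke_max_ideal m d (braid_pairs_below m k)"
    and "case_a \<equiv> (\<forall>a b. a \<noteq> b \<and> m a b < \<infinity> \<longrightarrow> \<not> m a b \<ge> k) \<and> (\<forall>i. d i = 2)"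
    and "case_b \<equiv> card (UNIV :: 'i set) = 1 \<and> (\<forall>i. d i \<ge> 3)"
  assumes "coxeter_matrix m"
    and "coxeter_irreducible m"
    and "\<forall>i. d i \<ge> 2"
    and "k \<ge> 1"
    and "ring.finite_dimension A (range \<eta>) (carrier A)"
  shows "(frobenius_algebra A \<eta>
            \<longleftrightarrow> ring.dimension A 1 (range \<eta>) (right_primitives A \<mm>))
       \<and> (ring.dimension A 1 (range \<eta>) (right_primitives A \<mm>)
            \<longleftrightarrow> ring.dimension A 1 (range \<eta>) (left_primitives A \<mm>))
       \<and> (ring.dimension A 1 (range \<eta>) (right_primitives A \<mm>)
            \<longleftrightarrow> right_primitives A \<mm> = left_primitives A \<mm>
              \<and> left_primitives A \<mm> = primitives A \<mm>
              \<and> ring.dimension A 1 (range \<eta>) (primitives A \<mm>))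
       \<and> (ring.dimension A 1 (range \<eta>) (right_primitives A \<mm>)
            \<longleftrightarrow> (case_a \<and> \<not> case_b) \<or> (\<not> case_a \<and> case_b))"
proof -
  define J0 where "J0 = braid_pairs_below m k"
  note pairs = braid_pairs_below_iff[OF assms(6), of _ _ k, folded J0_def]
  interpret N: nil_hecke_alg m J0 d "TYPE('k)"
    by unfold_locales (use assms in \<open>auto simp: J0_def braid_pairs_below_def\<close>)
  have A: "A = nil_hecke m d J0" and eta: "\<eta> = nil_hecke_scalar m d J0"
    and mm: "\<mm> = nil_hecke_max_ideal m d J0"
    by (simp_all add: A_def \<eta>_def \<mm>_def J0_def)
  note fin = assms(10)[unfolded A eta]
  obtain L where bound: "\<And>w. N.nonzero w \<Longrightarrow> length w \<le> L"
    using N.finite_dimension_bounded_length[OF fin] by blast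
  have exclusive: "(case_a \<and> \<not> case_b) \<or> (\<not> case_a \<and> case_b) \<longleftrightarrow> case_a \<or> case_b"
    by (auto simp: case_a_def case_b_def)
  have cases: "case_a \<or> case_b" if t: "N.socle_word t" for t
  proof (cases "\<exists>i i' :: 'i. i \<noteq> i'")
    case True
    have d: "d i = 2" for i
    proof -
      obtain i' where "i \<noteq> i'" using True by metis
      from N.socle_word_exponent[OF assms(7) J0_def t bound this] show ?thesis .
    qed
    then have "{a, b} \<in> J0" if "a \<noteq> b" for a b
      using N.socle_word_braid_pairs[OF t _ that] by blast
    then have case_a using d pairs by (auto simp: case_a_def not_le)
    then show ?thesis ..
  next
    case False
    then have "UNIV = {undefined :: 'i}" by auto
    from arg_cong[OF this, of card] have "card (UNIV :: 'i set) = 1" by simp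
    moreover have "(\<forall>i. d i = 2) \<or> (\<forall>i. d i \<ge> 3)"
    proof -
      have "d i = d undefined" for i using False by (metis (full_types))
      moreover have "d undefined = 2 \<or> d undefined \<ge> 3" using spec[OF assms(8), of undefined] by linarith
      ultimately show ?thesis by metis
    qed
    ultimately show ?thesis using False unfolding case_a_def case_b_def by blast
  qed
  have top: "\<exists>t. N.frobenius_word t" if "case_a \<or> case_b"
    using that
  proof
    assume case_a
    then have "{a, b} \<in> J0" if "a \<noteq> b" "m a b < \<infinity>" for a b
      using that pairs by (auto simp: case_a_def not_le)
    then have "braid_pairs m \<subseteq> J0" unfolding braid_pairs_def by blast
    then have "J0 = braid_pairs m" using N.J0 by blast
    moreover have "\<forall>i. d i = 2" using \<open>case_a\<close> by (simp add: case_a_def)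
    ultimately show ?thesis using N.frobenius_word_coxeter bound by blast
  next
    assume case_b
    then obtain c where "UNIV = {c :: 'i}" by (auto simp: case_b_def card_1_singleton_iff)
    then have "a = b" for a b :: 'i by (metis UNIV_I singletonD)
    from N.frobenius_word_rank_one[OF this] show ?thesis .
  qed
  show ?thesis
    unfolding exclusive
  proof (cases "case_a \<or> case_b")
    case True
    then obtain t where t: "N.frobenius_word t" using top by blast
    note prim = N.top_primitives[OF t, folded A eta mm]
    note dim = N.dimension_one_top[OF t, folded A eta mm]
    show "(frobenius_algebra A \<eta>
            \<longleftrightarrow> ring.dimension A 1 (range \<eta>) (right_primitives A \<mm>))
       \<and> (ring.dimension A 1 (range \<eta>) (right_primitives A \<mm>)
            \<longleftrightarrow> ring.dimension A 1 (range \<eta>) (left_primitives A \<mm>))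
       \<and> (ring.dimension A 1 (range \<eta>) (right_primitives A \<mm>)
            \<longleftrightarrow> right_primitives A \<mm> = left_primitives A \<mm>
              \<and> left_primitives A \<mm> = primitives A \<mm>
              \<and> ring.dimension A 1 (range \<eta>) (primitives A \<mm>))
       \<and> (ring.dimension A 1 (range \<eta>) (right_primitives A \<mm>) \<longleftrightarrow> case_a \<or> case_b)"
      using True N.frobenius_top[OF t fin, folded A eta] dim unfolding primitives_def prim by simp
  next
    case False
    then have no: "\<not> N.socle_word t" for t using cases by blast
    have "\<not> ring.dimension A 1 (range \<eta>) (right_primitives A \<mm>)"
      using N.dimension_one_right_socle_word[OF _ bound, folded A eta mm] no by blast
    moreover have "\<not> ring.dimension A 1 (range \<eta>) (left_primitives A \<mm>)"
      using N.dimension_one_left_socle_word[OF _ bound, folded A eta mm] no by blast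
    moreover have "\<not> frobenius_algebra A \<eta>"
      using N.frobenius_dimension_one[OF _ bound, folded A eta mm] calculation by blast
    ultimately show "(frobenius_algebra A \<eta>
            \<longleftrightarrow> ring.dimension A 1 (range \<eta>) (right_primitives A \<mm>))
       \<and> (ring.dimension A 1 (range \<eta>) (right_primitives A \<mm>)
            \<longleftrightarrow> ring.dimension A 1 (range \<eta>) (left_primitives A \<mm>))
       \<and> (ring.dimension A 1 (range \<eta>) (right_primitives A \<mm>)
            \<longleftrightarrow> right_primitives A \<mm> = left_primitives A \<mm>
              \<and> left_primitives A \<mm> = primitives A \<mm>
              \<and> ring.dimension A 1 (range \<eta>) (primitives A \<mm>))
       \<and> (ring.dimension A 1 (range \<eta>) (right_primitives A \<mm>) \<longleftrightarrow> case_a \<or> case_b)"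
      using False by metis
  qed
qed

end
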